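(* Let $k$ be an algebraically closed field of characteristic zero, let $\mathbf{A}^2=\mathrm{Spec}\,k[x_1,x_2]$ with origin $P$, and let $\mathfrak{a}=(x_1^2+x_2^3,\ x_1x_2^2)$ be the ideal generated by these two elements. Then $\mathrm{mld}_P(\mathbf{A}^2,\mathfrak{a}^{2/3})=2/3$, and there exists a unique divisor $E$ over $\mathbf{A}^2$ computing $\mathrm{mld}_P(\mathbf{A}^2,\mathfrak{a}^{2/3})$; but $E$ does not compute $\mathrm{mld}_P(\mathbf{A}^2,\mathfrak{a}^{2/3}\mathfrak{b})$ for any $\mathbf{R}$-ideal $\mathfrak{b}$ on $\mathbf{A}^2$ such that $\mathrm{mld}_P(\mathbf{A}^2,\mathfrak{a}^{2/3}\mathfrak{b})=0$.
   Context: We work over an algebraically closed field $k$ of characteristic zero. An $\mathbf{R}$-ideal on a variety $X$ is a formal product $\mathfrak{a}=\prod_j\mathfrak{a}_j^{r_j}$ of finitely many coherent ideal sheaves $\mathfrak{a}_j$ on $X$ with positive real exponents $r_j$; products of $\mathbf{R}$-ideals are formal products. The order of $\mathfrak{a}$ along a closed subvariety $C$ of $X$ is $\mathrm{ord}_C\mathfrak{a}=\sum_j r_j\,\mathrm{ord}_C\mathfrak{a}_j$, where $\mathrm{ord}_C\mathfrak{a}_j$ is the maximal $\nu\in\mathbf{N}\cup\{+\infty\}$ with $\mathfrak{a}_{j,\eta}\subset\mathcal{I}_\eta^\nu$, for $\mathcal{I}$ the ideal sheaf of $C$ and $\eta$ the generic point of $C$. For a birational morphism $Z\to X$, the pull-back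 is $\mathfrak{a}\mathcal{O}_Z=\prod_j(\mathfrak{a}_j\mathcal{O}_Z)^{r_j}$; if $Z$ is normal and $E$ is a prime divisor on $Z$, set $\mathrm{ord}_E\mathfrak{a}=\mathrm{ord}_E(\mathfrak{a}\mathcal{O}_Z)$. A divisor over $X$ is a prime divisor $E$ on a normal variety $Y$ equipped with a birational morphism $Y\to X$; its centre $c_X(E)$ is the closure of the image of $E$ in $X$. Two divisors over $X$ are identified if they define the same valuation on the function field of $X$ (uniqueness is meant in this sense). The set of divisors over $X$ is denoted $\mathcal{D}_X$. For $X$ smooth, the log discrepancy of $E\in\mathcal{D}_X$ (a divisor on $Y$) with respect to $(X,\mathfrak{a})$ is $a_E(X,\mathfrak{a})=1+\mathrm{ord}_E K_{Y/X}-\mathrm{ord}_E\mathfrak{a}$. The minimal log discrepancy at a closed point $P$ is $\mathrm{mld}_P(X,\mathfrak{a})=\inf\{a_E(X,\mathfrak{a})\mid E\in\mathcal{D}_X,\ c_X(E)=P\}$; it is either a non-negative real number or $-\infty$. A divisor $E\in\mathcal{D}_X$ computes $\mathrm{mld}_P(X,\mathfrak{a})$ if $c_X(E)=P$ and $a_E(X,\mathfrak{a})=\mathrm{mld}_P(X,\mathfrak{a})$ (or $a_E(X,\mathfrak{a})$ is negative, in the case $\mathrm{mld}_P(X,\mathfrak{a})=-\infty$). *)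

theory Defs
  imports
    "HOL-Computational_Algebra.Computational_Algebra"
    "HOL-Library.Extended_Real"
    "HOL-Library.Multiset"
begin

section \<open>The affine plane and its function field\<close>

text \<open>The coordinate ring \<open>k[x1, x2]\<close> is represented as \<open>k[x1][x2]\<close>: the outer variable is \<open>x2\<close>.\<close>

type_synonym 'k plane = "'k poly poly"
type_synonym 'k ratfun = "'k poly poly fract"

definition X1 :: "'k::field plane" where "X1 = [:[:0, 1:]:]"
definition X2 :: "'k::field plane" where "X2 = [:0, 1:]"

definition const :: "'k::field \<Rightarrow> 'k ratfun" where
  "const c = to_fract [:[:c:]:]"

lemma quotient_rule_welldef:
  fixes a b c d a' b' c' d' :: "'a::idom"
  assumes "b \<noteq> 0" "d \<noteq> 0" "a * d = c * b" "a * d' + d * a' = c * b' + b * c'"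
  shows "(a' * b - a * b') * (d * d) = (c' * d - c * d') * (b * b)"
proof -
  have "(a' * b - a * b') * (d * d) - (c' * d - c * d') * (b * b)
        = b * d * ((a * d' + d * a') - (c * b' + b * c'))
          - (b * d' + d * b') * (a * d - c * b)"
    by (simp add: algebra_simps)
  then show ?thesis using assms by simp
qed

lemma map_poly_pderiv_mult:
  "map_poly pderiv (p * q) = p * map_poly pderiv q + q * map_poly pderiv (p :: 'k::field plane)"
proof (rule poly_eqI)
  fix n
  have sumD: "pderiv (sum f S) = (\<Sum>i\<in>S. pderiv (f i))" if "finite S"
    for f :: "nat \<Rightarrow> 'k poly" and S
    using that by (induction S rule: finite_induct) (auto simp: pderiv_add)
  have "coeff (q * map_poly pderiv p) n = (\<Sum>i\<le>n. coeff q (n - i) * pderiv (coeff p i))"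
    unfolding mult.commute[of q "map_poly pderiv p"] coeff_mult
    by (rule sum.cong) (simp_all add: coeff_map_poly)
  then show "coeff (map_poly pderiv (p * q)) n
        = coeff (p * map_poly pderiv q + q * map_poly pderiv p) n"
    by (simp add: coeff_map_poly coeff_mult sumD pderiv_mult sum.distrib)
qed

definition extend_derivation :: "('a::idom \<Rightarrow> 'a) \<Rightarrow> 'a fract \<Rightarrow> 'a fract" where
  "extend_derivation D f =
     (THE h. \<exists>a b. b \<noteq> 0 \<and> f = Fract a b \<and> h = Fract (D a * b - a * D b) (b * b))"

lemma extend_derivation_Fract:
  assumes D: "\<And>p q. D (p * q) = p * D q + q * D p" and "b \<noteq> 0"
  shows "extend_derivation D (Fract a b) = Fract (D a * b - a * D b) (b * b)"
  unfolding extend_derivation_def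
proof (rule the_equality)
  show "\<exists>c d. d \<noteq> 0 \<and> Fract a b = Fract c d \<and>
          Fract (D a * b - a * D b) (b * b) = Fract (D c * d - c * D d) (d * d)"
    using \<open>b \<noteq> 0\<close> by blast
next
  fix h assume "\<exists>c d. d \<noteq> 0 \<and> Fract a b = Fract c d \<and> h = Fract (D c * d - c * D d) (d * d)"
  then obtain c d where d: "d \<noteq> 0" and "Fract a b = Fract c d"
    and h: "h = Fract (D c * d - c * D d) (d * d)" by blast
  then have eq: "a * d = c * b" using \<open>b \<noteq> 0\<close> by (simp add: eq_fract)
  have "a * D d + d * D a = c * D b + b * D c"
    using arg_cong[OF eq, of D] by (simp add: D)
  from quotient_rule_welldef[OF \<open>b \<noteq> 0\<close> d eq this]
  show "h = Fract (D a * b - a * D b) (b * b)"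
    unfolding h using \<open>b \<noteq> 0\<close> d by (simp add: eq_fract)
qed

definition partial_x1 :: "'k::field ratfun \<Rightarrow> 'k ratfun" where
  "partial_x1 = extend_derivation (map_poly pderiv)"

definition partial_x2 :: "'k::field ratfun \<Rightarrow> 'k ratfun" where
  "partial_x2 = extend_derivation pderiv"

lemma partial_Fract:
  assumes "b \<noteq> 0"
  shows "partial_x1 (Fract a b) = Fract (map_poly pderiv a * b - a * map_poly pderiv b) (b * b)"
    and "partial_x2 (Fract a b) = Fract (pderiv a * b - a * pderiv b) (b * b)"
  using assms
  by (simp_all add: partial_x1_def partial_x2_def extend_derivation_Fract
        map_poly_pderiv_mult pderiv_mult)

text \<open>\<open>df \<and> dg = jacobian f g dx1 \<and> dx2\<close> in the space \<open>K dx1 \<and> dx2\<close> of rational 2-forms.\<close>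

definition jacobian :: "'k::field ratfun \<Rightarrow> 'k ratfun \<Rightarrow> 'k ratfun" where
  "jacobian f g = partial_x1 f * partial_x2 g - partial_x2 f * partial_x1 g"


section \<open>Submodules, ideals and prime ideals\<close>

text \<open>\<open>R\<close> is a subring of the ambient ring; the submodules of \<open>R\<close> contained in \<open>R\<close> are its ideals.
  With \<open>R = UNIV\<close> one gets the ideals of the ambient ring itself.\<close>

definition submodule_over :: "'a::comm_ring_1 set \<Rightarrow> 'a set \<Rightarrow> bool" where
  "submodule_over R M \<longleftrightarrow>
     0 \<in> M \<and> (\<forall>x\<in>M. \<forall>y\<in>M. x + y \<in> M) \<and> (\<forall>r\<in>R. \<forall>x\<in>M. r * x \<in> M)"

definition span_over :: "'a::comm_ring_1 set \<Rightarrow> 'a set \<Rightarrow> 'a set" where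
  "span_over R S = submodule_over R hull S"

definition module_prod :: "'a::comm_ring_1 set \<Rightarrow> 'a set \<Rightarrow> 'a set \<Rightarrow> 'a set" where
  "module_prod R M N = span_over R {x * y | x y. x \<in> M \<and> y \<in> N}"

primrec ideal_power :: "'a::comm_ring_1 set \<Rightarrow> 'a set \<Rightarrow> nat \<Rightarrow> 'a set" where
  "ideal_power R I 0 = R"
| "ideal_power R I (Suc n) = module_prod R I (ideal_power R I n)"

definition prime_ideal_of :: "'a::comm_ring_1 set \<Rightarrow> 'a set \<Rightarrow> bool" where
  "prime_ideal_of R Q \<longleftrightarrow>
     submodule_over R Q \<and> Q \<subseteq> R \<and> 1 \<notin> Q \<and> (\<forall>a\<in>R. \<forall>b\<in>R. a * b \<in> Q \<longrightarrow> a \<in> Q \<or> b \<in> Q)"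


section \<open>Normal varieties birational over the plane\<close>

text \<open>A variety \<open>Y\<close> with function field \<open>K = k(x1, x2)\<close> is encoded, following Chevalley and
  Zariski--Samuel, by the set of its local rings \<open>\<O>_{Y,y} \<subseteq> K\<close> (\<open>y\<close> ranging over all
  scheme-theoretic points). Such a set is a finite union of sets of local rings of affine
  varieties, subject to separatedness in the form of the valuative criterion. A birational
  morphism from \<open>Y\<close> to the plane identifies the function fields, and it exists for this
  identification iff every affine chart contains \<open>k[x1, x2]\<close>.\<close>

definition subalgebra :: "'k::field ratfun set \<Rightarrow> bool" where
  "subalgebra A \<longleftrightarrow> range const \<subseteq> A \<and> (\<forall>x\<in>A. \<forall>y\<in>A. x + y \<in> A \<and> x * y \<in> A)"

definition finitely_generated_algebra :: "'k::field ratfun set \<Rightarrow> bool" where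
  "finitely_generated_algebra A \<longleftrightarrow> (\<exists>S. finite S \<and> A = subalgebra hull S)"

definition localization :: "'k::field ratfun set \<Rightarrow> 'k ratfun set \<Rightarrow> 'k ratfun set" where
  "localization A Q = {a / s | a s. a \<in> A \<and> s \<in> A - Q}"

definition local_rings :: "'k::field ratfun set \<Rightarrow> 'k ratfun set set" where
  "local_rings A = {localization A Q | Q. prime_ideal_of A Q}"

text \<open>The set of non-units, i.e. the maximal ideal of a local ring \<open>R\<close>.\<close>

definition max_ideal :: "'k::field ratfun set \<Rightarrow> 'k ratfun set" where
  "max_ideal R = {f \<in> R. f = 0 \<or> inverse f \<notin> R}"

definition valuation_ring :: "'k::field ratfun set \<Rightarrow> bool" where
  "valuation_ring V \<longleftrightarrow> subalgebra V \<and> (\<forall>f. f \<in> V \<or> inverse f \<in> V)"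

definition dominates :: "'k::field ratfun set \<Rightarrow> 'k ratfun set \<Rightarrow> bool" where
  "dominates V R \<longleftrightarrow> R \<subseteq> V \<and> max_ideal R = max_ideal V \<inter> R"

definition birational_over_plane :: "'k::field ratfun set set \<Rightarrow> bool" where
  "birational_over_plane Y \<longleftrightarrow>
     (\<exists>\<A>. finite \<A> \<and> \<A> \<noteq> {}
        \<and> (\<forall>A\<in>\<A>. finitely_generated_algebra A \<and> range to_fract \<subseteq> A)
        \<and> Y = (\<Union>A\<in>\<A>. local_rings A))
   \<and> (\<forall>V. valuation_ring V \<longrightarrow>
        (\<forall>R\<in>Y. \<forall>S\<in>Y. dominates V R \<and> dominates V S \<longrightarrow> R = S))"

definition integrally_closed :: "'k::field ratfun set \<Rightarrow> bool" where
  "integrally_closed R \<longleftrightarrow>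
     (\<forall>z. (\<exists>p. lead_coeff p = 1 \<and> (\<forall>i. coeff p i \<in> R) \<and> poly p z = 0) \<longrightarrow> z \<in> R)"

definition normal_variety :: "'k::field ratfun set set \<Rightarrow> bool" where
  "normal_variety Y \<longleftrightarrow> (\<forall>R\<in>Y. integrally_closed R)"


section \<open>Divisors over the plane\<close>

text \<open>A prime divisor on \<open>Y\<close> is given by its generic point, a point of codimension one. It is
  represented by the local ring at that point, a member of \<open>Y\<close> of Krull dimension one.\<close>

definition prime_divisors :: "'k::field ratfun set set \<Rightarrow> 'k ratfun set set" where
  "prime_divisors Y =
     {E \<in> Y. max_ideal E \<noteq> {0} \<and> {Q. prime_ideal_of E Q} = {{0}, max_ideal E}}"

definition divisors_over_plane :: "'k::field ratfun set set" where
  "divisors_over_plane =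
     {E. \<exists>Y. birational_over_plane Y \<and> normal_variety Y \<and> E \<in> prime_divisors Y}"

text \<open>Closed subsets of the plane are sets of scheme-theoretic points, i.e. of prime ideals of
  \<open>k[x1, x2]\<close>. The image of the generic point of \<open>E\<close> is the contraction of the maximal ideal.\<close>

definition centre :: "'k::field ratfun set \<Rightarrow> 'k plane set set" where
  "centre E = {Q. prime_ideal_of UNIV Q \<and> {f. to_fract f \<in> max_ideal E} \<subseteq> Q}"

definition origin :: "'k::field plane set" where
  "origin = span_over UNIV {X1, X2}"

definition order_along :: "'k::field ratfun set \<Rightarrow> 'k ratfun set \<Rightarrow> enat" where
  "order_along E I = Sup {enat n | n. I \<subseteq> ideal_power E (max_ideal E) n}"

definition valuation :: "'k::field ratfun set \<Rightarrow> 'k ratfun \<Rightarrow> int" where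
  "valuation E f = (THE n. \<exists>a\<in>E - {0}. \<exists>b\<in>E - {0}. f = a / b \<and>
      n = int (the_enat (order_along E (span_over E {a})))
          - int (the_enat (order_along E (span_over E {b}))))"

definition same_divisor :: "'k::field ratfun set \<Rightarrow> 'k ratfun set \<Rightarrow> bool" where
  "same_divisor E F \<longleftrightarrow> (\<forall>f. f \<noteq> 0 \<longrightarrow> valuation E f = valuation F f)"

text \<open>The stalk of \<open>\<omega>_Y\<close> at the generic point of \<open>E\<close>, in terms of the basis \<open>dx1 \<and> dx2\<close> of the
  rational 2-forms. It is generated by the forms \<open>df \<and> dg\<close> with \<open>f, g\<close> in the local ring; as this
  ring is regular and \<open>char k = 0\<close>, its module of 2-forms embeds into the rational ones.
  The divisor \<open>K_{Y/X}\<close> is that of \<open>dx1 \<and> dx2\<close>, pulled back to \<open>Y\<close>, as a section of \<open>\<omega>_Y\<close>.\<close>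

definition canonical_stalk :: "'k::field ratfun set \<Rightarrow> 'k ratfun set" where
  "canonical_stalk E = span_over E {jacobian f g | f g. f \<in> E \<and> g \<in> E}"

definition order_relative_canonical :: "'k::field ratfun set \<Rightarrow> enat" where
  "order_relative_canonical E =
     Sup {enat n | n. 1 \<in> module_prod E (ideal_power E (max_ideal E) n) (canonical_stalk E)}"


section \<open>R-ideals and minimal log discrepancies\<close>

text \<open>Coherent ideal sheaves on the plane are ideals of \<open>k[x1, x2]\<close>. The product of R-ideals is
  the sum of multisets.\<close>

type_synonym 'k rideal = "('k plane set \<times> real) multiset"

definition R_ideal :: "'k::field rideal \<Rightarrow> bool" where
  "R_ideal \<aa> \<longleftrightarrow> (\<forall>(I, r)\<in>#\<aa>. submodule_over UNIV I \<and> r > 0)"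

definition ord_R_ideal :: "'k::field ratfun set \<Rightarrow> 'k rideal \<Rightarrow> ereal" where
  "ord_R_ideal E \<aa> =
     (\<Sum>(I, r)\<in>#\<aa>. ereal r * ereal_of_enat (order_along E (span_over E (to_fract ` I))))"

definition log_discrepancy :: "'k::field ratfun set \<Rightarrow> 'k rideal \<Rightarrow> ereal" where
  "log_discrepancy E \<aa> = 1 + ereal_of_enat (order_relative_canonical E) - ord_R_ideal E \<aa>"

definition mld :: "'k::field plane set \<Rightarrow> 'k rideal \<Rightarrow> ereal" where
  "mld P \<aa> = (INF E\<in>{E \<in> divisors_over_plane. centre E = {P}}. log_discrepancy E \<aa>)"

definition computes_mld :: "'k::field ratfun set \<Rightarrow> 'k plane set \<Rightarrow> 'k rideal \<Rightarrow> bool" where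
  "computes_mld E P \<aa> \<longleftrightarrow>
     E \<in> divisors_over_plane \<and> centre E = {P}
     \<and> (log_discrepancy E \<aa> = mld P \<aa> \<or> mld P \<aa> = -\<infinity> \<and> log_discrepancy E \<aa> < 0)"

end

theory Submission
  imports Defs "Berlekamp_Zassenhaus.Unique_Factorization_Poly"
begin

text \<open>For a divisor over the origin with valuation \<open>v\<close>, the forms \<open>df \<and> dg / (f g)\<close> have at most a simple pole.
  With \<open>dx1 \<and> dx2 / (x1 x2)\<close> this bounds the log discrepancy of the plane below by \<open>v x1 + v x2\<close>, which settles
  the case \<open>2 v x1 \<noteq> 3 v x2\<close>. Otherwise the same form, rewritten in \<open>(x1\<^sup>2 + x2\<^sup>3) / x2\<^sup>3\<close> and \<open>x1 / x2\<close>, gives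
  a bound that grows with \<open>v (x1\<^sup>2 + x2\<^sup>3)\<close>. So \<open>2/3\<close> is attained only if \<open>v x1 = v x2 = 1\<close> and
  \<open>x1 / x2 - c\<close> is a unit for each constant \<open>c\<close>, which is the exceptional divisor \<open>E\<close> of the blow-up of the origin.
  If \<open>E\<close> has log discrepancy 0 with respect to \<open>\<aa>\<^bsup>2/3\<^esup> \<bb>\<close>, then \<open>\<bb>\<close> has order \<open>2/3\<close> along \<open>E\<close>,
  hence order at least \<open>4/3\<close> along the divisor \<open>F\<close> of weights \<open>(3, 2)\<close>, whose log discrepancy is therefore
  at most \<open>5 - (2/3) 6 - 4/3 < 0\<close>.\<close>

section \<open>Noetherian subrings of fields\<close>

text \<open>A divisor is given as a local ring of an abstract normal variety, whereas every estimate
  speaks of a valuation. The passage between the two is asymmetric. An arbitrary divisor has to be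
  recognized as a discrete valuation ring, as a Noetherian normal local ring with only two primes.
  Existence is needed for only two explicit divisors, each a coordinate line in a copy of
  \<open>Spec k[u, s]\<close>, where normality follows from unique factorization. Likewise the order
  of the canonical divisor is bounded below for all divisors, by writing
  \<open>dx1 \<and> dx2\<close> as a multiple of \<open>df \<and> dg\<close> for well chosen
  \<open>f, g\<close>, but bounded above only in the two charts. The second form is unavoidable when
  \<open>2 v x1 = 3 v x2\<close>: cancellation may raise the order of \<open>x1^2 + x2^3\<close>,
  and for weights \<open>(3, 2)\<close> the ideal could have order 7, with
  \<open>5 - (2/3) 7 = 1/3\<close> too small. The step from \<open>2/3\<close> to \<open>4/3\<close>
  rests on a factor 2: a polynomial of order \<open>n\<close> along \<open>E\<close> is
  \<open>x2^n\<close> times a polynomial in \<open>x1/x2\<close> and \<open>x2\<close>, and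
  \<open>x2\<close> has weight 2 along \<open>F\<close>.\<close>

definition is_subring :: "'a::comm_ring_1 set \<Rightarrow> bool" where
  "is_subring R \<longleftrightarrow> 1 \<in> R \<and> (\<forall>x\<in>R. \<forall>y\<in>R. x - y \<in> R \<and> x * y \<in> R)"

lemma is_subringD:
  assumes "is_subring R"
  shows "0 \<in> R" "1 \<in> R" "x \<in> R \<Longrightarrow> y \<in> R \<Longrightarrow> x - y \<in> R" "x \<in> R \<Longrightarrow> y \<in> R \<Longrightarrow> x * y \<in> R"
    "x \<in> R \<Longrightarrow> - x \<in> R" "x \<in> R \<Longrightarrow> y \<in> R \<Longrightarrow> x + y \<in> R" "x \<in> R \<Longrightarrow> x ^ n \<in> R"
proof -
  have minus: "x - y \<in> R" and times: "x * y \<in> R" if "x \<in> R" "y \<in> R" for x y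
    using assms that by (auto simp: is_subring_def)
  show one: "1 \<in> R" using assms by (simp add: is_subring_def)
  show zero: "0 \<in> R" using minus[OF one one] by simp
  have neg: "- x \<in> R" if "x \<in> R" for x using minus[OF zero that] by simp
  show "x \<in> R \<Longrightarrow> - x \<in> R" by (rule neg)
  show "x \<in> R \<Longrightarrow> y \<in> R \<Longrightarrow> x - y \<in> R" by (rule minus)
  show "x \<in> R \<Longrightarrow> y \<in> R \<Longrightarrow> x * y \<in> R" by (rule times)
  show "x \<in> R \<Longrightarrow> y \<in> R \<Longrightarrow> x + y \<in> R" using minus[OF _ neg, of x y] by simp
  show "x \<in> R \<Longrightarrow> x ^ n \<in> R" by (induction n) (auto simp: one times)
qed

lemma is_subring_sum:
  assumes "is_subring R" "\<And>i. i \<in> S \<Longrightarrow> f i \<in> R"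
  shows "sum f S \<in> R"
  using assms(2) by (induction S rule: infinite_finite_induct) (auto simp: is_subringD[OF assms(1)])

lemma submodule_overD:
  assumes "submodule_over R M"
  shows "0 \<in> M" "x \<in> M \<Longrightarrow> y \<in> M \<Longrightarrow> x + y \<in> M" "r \<in> R \<Longrightarrow> x \<in> M \<Longrightarrow> r * x \<in> M"
  using assms by (auto simp: submodule_over_def)

lemma submodule_over_diff:
  assumes "is_subring R" "submodule_over R M" "x \<in> M" "y \<in> M"
  shows "x - y \<in> M"
  using submodule_overD(2)[OF assms(2,3), of "-1 * y"] submodule_overD(3)[OF assms(2) _ assms(4), of "-1"]
    is_subringD(2,5)[OF assms(1)] by simp

lemma submodule_over_span: "submodule_over R (span_over R S)"
  unfolding span_over_def by (rule hull_in) (auto simp: submodule_over_def)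

lemma span_over_superset: "S \<subseteq> span_over R S"
  unfolding span_over_def by (rule hull_subset)

lemma span_over_minimal: "S \<subseteq> M \<Longrightarrow> submodule_over R M \<Longrightarrow> span_over R S \<subseteq> M"
  unfolding span_over_def by (rule hull_minimal)

lemma submodule_over_subset: "submodule_over R M \<Longrightarrow> A \<subseteq> R \<Longrightarrow> submodule_over A M"
  by (auto simp: submodule_over_def)

lemma submodule_over_principal:
  assumes "is_subring R"
  shows "submodule_over R {r * x | r. r \<in> R}"
  unfolding submodule_over_def
proof (intro conjI ballI)
  show "0 \<in> {r * x | r. r \<in> R}" using is_subringD(1)[OF assms] by force
next
  fix a b assume "a \<in> {r * x | r. r \<in> R}" "b \<in> {r * x | r. r \<in> R}"
  then obtain r s where "r \<in> R" "s \<in> R" "a = r * x" "b = s * x" by blast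
  then show "a + b \<in> {r * x | r. r \<in> R}"
    using is_subringD(6)[OF assms, of r s] by (auto simp: distrib_right intro!: exI[of _ "r + s"])
next
  fix a b assume "a \<in> R" "b \<in> {r * x | r. r \<in> R}"
  then obtain r where "r \<in> R" "b = r * x" by blast
  then show "a * b \<in> {r * x | r. r \<in> R}"
    using is_subringD(4)[OF assms, of a r] \<open>a \<in> R\<close> by (auto simp: mult.assoc intro!: exI[of _ "a * r"])
qed

definition noetherian :: "'a::comm_ring_1 set \<Rightarrow> bool" where
  "noetherian R \<longleftrightarrow>
     (\<forall>I. submodule_over R I \<and> I \<subseteq> R \<longrightarrow> (\<exists>F. finite F \<and> F \<subseteq> I \<and> I \<subseteq> span_over R F))"

lemma noetherianD:
  assumes "noetherian R" "submodule_over R I" "I \<subseteq> R"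
  obtains F where "finite F" "F \<subseteq> I" "I \<subseteq> span_over R F"
  using assms unfolding noetherian_def by meson

text \<open>Zorn's lemma applies because finitely many generators of the union of a chain already
  lie in one member, which then equals the union.\<close>

lemma noetherian_maximal_ideal:
  assumes noeth: "noetherian R" and "\<F> \<noteq> {}"
    and ideals: "\<And>I. I \<in> \<F> \<Longrightarrow> submodule_over R I \<and> I \<subseteq> R"
  shows "\<exists>M\<in>\<F>. \<forall>I\<in>\<F>. M \<subseteq> I \<longrightarrow> I = M"
proof (rule subset_Zorn_nonempty[OF \<open>\<F> \<noteq> {}\<close>])
  fix \<C> assume ne: "\<C> \<noteq> {}" and chain: "subset.chain \<F> \<C>"
  then have sub: "\<C> \<subseteq> \<F>" and total: "\<And>I J. I \<in> \<C> \<Longrightarrow> J \<in> \<C> \<Longrightarrow> I \<subseteq> J \<or> J \<subseteq> I"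
    by (auto simp: subset_chain_def)
  have "submodule_over R (\<Union>\<C>)"
    unfolding submodule_over_def
  proof (intro conjI ballI)
    show "0 \<in> \<Union>\<C>" using ne sub ideals submodule_overD(1) by blast
  next
    fix x y assume "x \<in> \<Union>\<C>" "y \<in> \<Union>\<C>"
    then obtain I where "I \<in> \<C>" "x \<in> I" "y \<in> I" using total by blast
    then show "x + y \<in> \<Union>\<C>" using sub ideals submodule_overD(2) by blast
  next
    fix r x assume "r \<in> R" "x \<in> \<Union>\<C>"
    then show "r * x \<in> \<Union>\<C>" using sub ideals submodule_overD(3) by blast
  qed
  moreover have "\<Union>\<C> \<subseteq> R" using sub ideals by blast
  ultimately obtain F where F: "finite F" "F \<subseteq> \<Union>\<C>" "\<Union>\<C> \<subseteq> span_over R F"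
    by (rule noetherianD[OF noeth])
  obtain I where I: "I \<in> \<C>" "F \<subseteq> I"
    using finite_subset_Union_chain[OF F(1,2) ne chain] by blast
  then have "span_over R F \<subseteq> I" using span_over_minimal sub ideals by blast
  then have "\<Union>\<C> = I" using F(3) I(1) by blast
  then show "\<Union>\<C> \<in> \<F>" using I(1) sub by blast
qed

lemma noetherian_ascending_chain:
  fixes I :: "nat \<Rightarrow> 'a::comm_ring_1 set"
  assumes noeth: "noetherian R" and ideals: "\<And>n. submodule_over R (I n) \<and> I n \<subseteq> R"
    and mono: "\<And>n. I n \<subseteq> I (Suc n)"
  obtains N where "\<And>n. n \<ge> N \<Longrightarrow> I n = I N"
proof -
  obtain M where "M \<in> range I" and max: "\<forall>J\<in>range I. M \<subseteq> J \<longrightarrow> J = M"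
    using noetherian_maximal_ideal[OF noeth, of "range I"] ideals by blast
  then obtain N where N: "M = I N" by blast
  have "I N \<subseteq> I n" if "n \<ge> N" for n using lift_Suc_mono_le[of I, OF mono that] .
  then have "I n = I N" if "n \<ge> N" for n using max that unfolding N by blast
  then show thesis by (rule that)
qed

text \<open>The ring \<open>R[s]\<close> inside the field. As \<open>s\<close> may be algebraic over
  \<open>R\<close>, an element need not determine the polynomial representing it.\<close>

definition adjoin :: "'a::field set \<Rightarrow> 'a \<Rightarrow> 'a set" where
  "adjoin R s = {poly p s | p. \<forall>i. coeff p i \<in> R}"

lemma coeff_mult_mem:
  assumes "is_subring R" "\<forall>i. coeff p i \<in> R" "\<forall>i. coeff q i \<in> R"
  shows "coeff (p * q) i \<in> R"
  unfolding coeff_mult using assms by (auto intro!: is_subring_sum is_subringD(4)[OF assms(1)])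

lemma is_subring_adjoin:
  assumes "is_subring R"
  shows "is_subring (adjoin R s)" "R \<subseteq> adjoin R s" "s \<in> adjoin R s"
proof -
  show "R \<subseteq> adjoin R s"
  proof
    fix r assume "r \<in> R"
    then have "\<forall>i. coeff [:r:] i \<in> R"
      using is_subringD(1)[OF assms] by (auto simp: coeff_pCons split: nat.splits)
    then show "r \<in> adjoin R s" unfolding adjoin_def by (intro CollectI exI[of _ "[:r:]"]) simp
  qed
  show "s \<in> adjoin R s" unfolding adjoin_def
    using is_subringD(1,2)[OF assms]
    by (intro CollectI exI[of _ "[:0, 1:]"]) (auto simp: coeff_pCons split: nat.splits)
  have "1 \<in> adjoin R s" using \<open>R \<subseteq> adjoin R s\<close> is_subringD(2)[OF assms] by blast
  moreover have "x - y \<in> adjoin R s \<and> x * y \<in> adjoin R s"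
    if xy: "x \<in> adjoin R s" "y \<in> adjoin R s" for x y
  proof -
    obtain p q where p: "x = poly p s" "\<forall>i. coeff p i \<in> R" and q: "y = poly q s" "\<forall>i. coeff q i \<in> R"
      using xy unfolding adjoin_def by blast
    have "\<forall>i. coeff (p - q) i \<in> R" "\<forall>i. coeff (p * q) i \<in> R"
      using p(2) q(2) is_subringD(3)[OF assms] coeff_mult_mem[OF assms p(2) q(2)] by auto
    moreover have "x - y = poly (p - q) s" "x * y = poly (p * q) s" by (simp_all add: p(1) q(1))
    ultimately show ?thesis unfolding adjoin_def by blast
  qed
  ultimately show "is_subring (adjoin R s)" by (auto simp: is_subring_def)
qed

text \<open>The leading coefficient argument, run on the polynomials whose value at \<open>s\<close>
  lies in \<open>I\<close>, since elements of \<open>R[s]\<close> themselves have no well-defined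
  degree.\<close>

theorem hilbert_basis:
  fixes R :: "'a::field set"
  assumes sub: "is_subring R" and noeth: "noetherian R"
  shows "noetherian (adjoin R s)"
  unfolding noetherian_def
proof (intro allI impI)
  fix I assume I: "submodule_over (adjoin R s) I \<and> I \<subseteq> adjoin R s"
  note R = is_subringD[OF sub]
  note R' = is_subring_adjoin[OF sub, of s]
  note I_sub = submodule_overD[OF conjunct1[OF I]]
  define P where "P = {p. (\<forall>i. coeff p i \<in> R) \<and> poly p s \<in> I}"
  \<comment> \<open>Coefficients in position \<open>n\<close> of members of degree at most
    \<open>n\<close>. Allowing coefficient 0 makes \<open>L n\<close> an ideal, and multiplication
    by the variable makes the sequence increase.\<close>
  define L where "L n = {coeff p n | p. p \<in> P \<and> (\<forall>i>n. coeff p i = 0)}" for n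
  have P_diff: "p - q \<in> P" if "p \<in> P" "q \<in> P" for p q
    using that R(3) submodule_over_diff[OF R'(1) conjunct1[OF I]] by (auto simp: P_def)
  have P_add: "p + q \<in> P" if "p \<in> P" "q \<in> P" for p q
    using that R(6) I_sub(2) by (auto simp: P_def)
  have P_smult: "smult r p \<in> P" if "r \<in> R" "p \<in> P" for r p
    using that R(4) I_sub(3) R'(2) by (auto simp: P_def)
  have P_pCons: "pCons 0 p \<in> P" if "p \<in> P" for p
    using that R(1) I_sub(3) R'(3) by (auto simp: P_def coeff_pCons split: nat.splits)
  have P_0: "0 \<in> P" using R(1) I_sub(1) by (auto simp: P_def)
  have L_ideal: "submodule_over R (L n) \<and> L n \<subseteq> R" for n
  proof (intro conjI)
    show "L n \<subseteq> R" by (auto simp: L_def P_def)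
    show "submodule_over R (L n)"
      unfolding submodule_over_def
    proof (intro conjI ballI)
      show "0 \<in> L n" using P_0 by (auto simp: L_def intro!: exI[of _ 0])
    next
      fix x y assume "x \<in> L n" "y \<in> L n"
      then obtain p q where "p \<in> P" "q \<in> P" "\<forall>i>n. coeff p i = 0" "\<forall>i>n. coeff q i = 0"
        "x = coeff p n" "y = coeff q n" unfolding L_def by blast
      then show "x + y \<in> L n" using P_add by (auto simp: L_def intro!: exI[of _ "p + q"])
    next
      fix r x assume "r \<in> R" "x \<in> L n"
      then obtain p where "p \<in> P" "\<forall>i>n. coeff p i = 0" "x = coeff p n" unfolding L_def by blast
      then show "r * x \<in> L n" using P_smult \<open>r \<in> R\<close> by (auto simp: L_def intro!: exI[of _ "smult r p"])
    qed
  qed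
  have L_mono: "L n \<subseteq> L (Suc n)" for n
  proof
    fix x assume "x \<in> L n"
    then obtain p where "p \<in> P" "\<forall>i>n. coeff p i = 0" "x = coeff p n" unfolding L_def by blast
    then show "x \<in> L (Suc n)"
      using P_pCons by (auto simp: L_def coeff_pCons intro!: exI[of _ "pCons 0 p"] split: nat.splits)
  qed
  obtain N where N: "\<And>n. n \<ge> N \<Longrightarrow> L n = L N"
    using noetherian_ascending_chain[of R L, OF noeth L_ideal L_mono] by blast
  have "\<forall>n. \<exists>F. finite F \<and> F \<subseteq> L n \<and> L n \<subseteq> span_over R F"
    using noeth L_ideal unfolding noetherian_def by simp
  from choice[OF this] obtain F
    where F: "\<And>n. finite (F n)" "\<And>n. F n \<subseteq> L n" "\<And>n. L n \<subseteq> span_over R (F n)"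
    by blast
  define g where "g n c = (SOME p. p \<in> P \<and> (\<forall>i>n. coeff p i = 0) \<and> coeff p n = c)" for n c
  have g: "g n c \<in> P \<and> (\<forall>i>n. coeff (g n c) i = 0) \<and> coeff (g n c) n = c" if "c \<in> F n" for n c
    unfolding g_def by (rule someI_ex) (use subsetD[OF F(2) that] in \<open>auto simp: L_def\<close>)
  \<comment> \<open>Beyond \<open>N\<close> the ideals \<open>L n\<close> are constant, so lifting
    generators of the first \<open>N + 1\<close> of them yields a finite set.\<close>
  define G where "G = (\<Union>n\<le>N. (\<lambda>c. poly (g n c) s) ` F n)"
  let ?S = "span_over (adjoin R s) G"
  note S_sub = submodule_overD[OF submodule_over_span[of "adjoin R s" G]]
  have lift: "\<exists>q\<in>P. (\<forall>i>n. coeff q i = 0) \<and> coeff q n = c \<and> poly q s \<in> ?S"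
    if "n \<le> N" "c \<in> L n" for n c
  proof -
    \<comment> \<open>The coefficients that can be lifted form an ideal, so it is enough that
      generators of \<open>L n\<close> lift.\<close>
    let ?T = "{c. \<exists>q\<in>P. (\<forall>i>n. coeff q i = 0) \<and> coeff q n = c \<and> poly q s \<in> ?S}"
    have "F n \<subseteq> ?T"
    proof
      fix c assume "c \<in> F n"
      moreover from this have "poly (g n c) s \<in> ?S"
        using \<open>n \<le> N\<close> span_over_superset[of G "adjoin R s"] by (auto simp: G_def)
      ultimately show "c \<in> ?T" using g by blast
    qed
    moreover have "submodule_over R ?T"
      unfolding submodule_over_def
    proof (intro conjI ballI)
      show "0 \<in> ?T" using P_0 S_sub(1) by (auto intro!: bexI[of _ 0])
    next
      fix x y assume "x \<in> ?T" "y \<in> ?T"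
      then obtain p q where "p \<in> P" "q \<in> P" "\<forall>i>n. coeff p i = 0" "\<forall>i>n. coeff q i = 0"
        "x = coeff p n" "y = coeff q n" "poly p s \<in> ?S" "poly q s \<in> ?S" by blast
      then show "x + y \<in> ?T" using P_add S_sub(2) by (auto intro!: bexI[of _ "p + q"])
    next
      fix r x assume "r \<in> R" "x \<in> ?T"
      then obtain p where "p \<in> P" "\<forall>i>n. coeff p i = 0" "x = coeff p n" "poly p s \<in> ?S" by blast
      then show "r * x \<in> ?T"
        using P_smult \<open>r \<in> R\<close> S_sub(3) R'(2) by (auto intro!: bexI[of _ "smult r p"])
    qed
    ultimately have "span_over R (F n) \<subseteq> ?T" by (rule span_over_minimal)
    then show ?thesis using that(2) F(3) by blast
  qed
  have shift: "smult r (monom 1 k * q) \<in> P \<and> poly (smult r (monom 1 k * q)) s \<in> ?S"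
    if "r \<in> R" "q \<in> P" "poly q s \<in> ?S" for r k q
  proof -
    have "monom 1 k * q \<in> P"
      using that(2) P_pCons by (induction k) (auto simp: monom_Suc)
    moreover have "poly (monom 1 k * q) s \<in> ?S"
      using that(3) S_sub(3) is_subringD(7)[OF R'(1) R'(3)] by (simp add: poly_monom)
    ultimately show ?thesis using P_smult that(1) S_sub(3) R'(2) by auto
  qed
  have "poly p s \<in> ?S" if "p \<in> P" "\<forall>i\<ge>n. coeff p i = 0" for p n
    using that
  proof (induction n arbitrary: p)
    case 0
    then have "p = 0" by (auto simp: poly_eq_iff)
    then show ?case using S_sub(1) by simp
  next
    case (Suc n)
    \<comment> \<open>For \<open>n > N\<close> the top coefficient already lies in
      \<open>L N\<close>. A lift of degree \<open>N\<close>, multiplied by the missing power of the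
      variable, cancels it.\<close>
    define m where "m = min n N"
    have "coeff p n \<in> L n" using Suc.prems by (auto simp: L_def)
    then have "coeff p n \<in> L m" using N[of n] by (cases "n \<le> N") (auto simp: m_def min_def)
    then obtain q where q: "q \<in> P" "\<forall>i>m. coeff q i = 0" "coeff q m = coeff p n" "poly q s \<in> ?S"
      using lift[of m] by (auto simp: m_def)
    define q' where "q' = smult 1 (monom 1 (n - m) * q)"
    have q': "q' \<in> P" "poly q' s \<in> ?S" using shift[OF R(2) q(1,4)] by (auto simp: q'_def)
    have "m \<le> n" by (simp add: m_def)
    have "coeff (p - q') i = 0" if "n \<le> i" for i
    proof (cases "i = n")
      case True
      then show ?thesis using q(3) \<open>m \<le> n\<close> by (simp add: q'_def coeff_monom_mult)
    next
      case False
      then have "Suc n \<le> i" "m < i - (n - m)" using that \<open>m \<le> n\<close> by linarith+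
      then show ?thesis using q(2) Suc.prems(2) by (simp add: q'_def coeff_monom_mult)
    qed
    then have "\<forall>i\<ge>n. coeff (p - q') i = 0" by blast
    then have "poly (p - q') s \<in> ?S" using Suc.IH P_diff[OF Suc.prems(1) q'(1)] by blast
    then show ?case using S_sub(2)[OF _ q'(2)] by fastforce
  qed
  then have "I \<subseteq> ?S"
  proof (intro subsetI)
    fix x assume "x \<in> I"
    then obtain p where "p \<in> P" "x = poly p s" using I by (auto simp: adjoin_def P_def)
    then show "x \<in> ?S"
      using \<open>\<And>n p. p \<in> P \<Longrightarrow> \<forall>i\<ge>n. coeff p i = 0 \<Longrightarrow> poly p s \<in> ?S\<close>[of p "Suc (degree p)"]
      by (auto simp: coeff_eq_0)
  qed
  moreover have "finite G" using F(1) by (auto simp: G_def)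
  moreover have "G \<subseteq> I" using g by (auto simp: G_def P_def)
  ultimately show "\<exists>F. finite F \<and> F \<subseteq> I \<and> I \<subseteq> span_over (adjoin R s) F" by blast
qed

lemma noetherian_subfield:
  fixes R :: "'a::field set"
  assumes "is_subring R" and inv: "\<And>x. x \<in> R \<Longrightarrow> inverse x \<in> R"
  shows "noetherian R"
  unfolding noetherian_def
proof (intro allI impI)
  fix I assume I: "submodule_over R I \<and> I \<subseteq> R"
  show "\<exists>F. finite F \<and> F \<subseteq> I \<and> I \<subseteq> span_over R F"
  proof (cases "I \<subseteq> {0}")
    case True
    then show ?thesis
      using submodule_overD(1)[OF submodule_over_span[of R "{}"]] by (intro exI[of _ "{}"]) auto
  next
    case False
    then obtain a where a: "a \<in> I" "a \<noteq> 0" by blast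
    have "x \<in> span_over R {a}" if "x \<in> I" for x
    proof -
      have "x * inverse a \<in> R" using I a(1) that inv is_subringD(4)[OF assms(1)] by blast
      then have "(x * inverse a) * a \<in> span_over R {a}"
        using submodule_overD(3)[OF submodule_over_span[of R "{a}"]] span_over_superset[of "{a}" R] by blast
      moreover have "(x * inverse a) * a = x" using a(2) by (simp add: mult.assoc)
      ultimately show ?thesis by simp
    qed
    then show ?thesis using a(1) by (intro exI[of _ "{a}"]) auto
  qed
qed

section \<open>Finitely generated algebras over the constants\<close>

lemma const_simps [simp]:
  "const 0 = (0::'k::field ratfun)" "const 1 = (1::'k ratfun)"
  "const (a + b) = const a + (const b::'k ratfun)" "const (a - b) = const a - (const b::'k ratfun)"
  "const (a * b) = const a * (const b::'k ratfun)" "const (- a) = - (const a::'k ratfun)"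
proof -
  show "const 1 = (1::'k ratfun)" unfolding const_def by (metis pCons_one to_fract_1)
qed (simp_all add: const_def flip: to_fract_add to_fract_diff to_fract_mult to_fract_uminus)

lemma const_eq_0_iff [simp]: "const c = 0 \<longleftrightarrow> c = 0"
  by (simp add: const_def)

lemma const_inverse: "const (inverse c) = inverse (const c :: 'k::field ratfun)"
proof (cases "c = 0")
  case False
  then have "const (inverse c) * const c = (1 :: 'k ratfun)" by (simp flip: const_simps)
  then show ?thesis using False by (simp add: field_simps)
qed simp

lemma is_subring_subalgebra:
  assumes "subalgebra (A :: 'k::field ratfun set)"
  shows "is_subring A"
proof -
  have const: "const c \<in> A" for c using assms by (auto simp: subalgebra_def)
  have "x - y \<in> A" if "x \<in> A" "y \<in> A" for x y
  proof -
    have "const (-1) * y \<in> A" using assms const that unfolding subalgebra_def by blast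
    then have "x + const (-1) * y \<in> A" using assms that unfolding subalgebra_def by blast
    then show ?thesis by simp
  qed
  moreover have "x * y \<in> A" if "x \<in> A" "y \<in> A" for x y
    using assms that by (auto simp: subalgebra_def)
  moreover have "1 \<in> A" using const[of 1] by simp
  ultimately show ?thesis unfolding is_subring_def by blast
qed

lemma subalgebra_hull: "subalgebra (subalgebra hull S)"
  by (rule hull_in) (auto simp: subalgebra_def)

lemma poly_mem_subalgebra:
  assumes "subalgebra A" "\<forall>i. coeff p i \<in> A" "s \<in> A"
  shows "poly p s \<in> A"
  unfolding poly_altdef using is_subring_subalgebra[OF assms(1)] assms(2,3)
  by (auto intro!: is_subring_sum is_subringD(4) is_subringD(7))

lemma subalgebra_adjoin:
  assumes "subalgebra A"
  shows "subalgebra (adjoin A s)"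
proof -
  note sub = is_subring_adjoin[OF is_subring_subalgebra[OF assms], of s]
  have "range const \<subseteq> A" using assms by (simp add: subalgebra_def)
  then show ?thesis
    using sub(2) is_subringD(4,6)[OF sub(1)] unfolding subalgebra_def by blast
qed

text \<open>Adjoining generators one at a time is what makes \<open>hilbert_basis\<close> applicable
  by induction.\<close>

lemma subalgebra_hull_insert: "subalgebra hull (insert s S) = adjoin (subalgebra hull S) s"
proof (rule hull_unique)
  note sub = is_subring_adjoin[OF is_subring_subalgebra[OF subalgebra_hull[of S]], of s]
  show "insert s S \<subseteq> adjoin (subalgebra hull S) s" using sub(2,3) hull_subset[of S subalgebra] by blast
  show "subalgebra (adjoin (subalgebra hull S) s)" by (rule subalgebra_adjoin[OF subalgebra_hull])
  fix A assume A: "insert s S \<subseteq> A" "subalgebra A"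
  then have "subalgebra hull S \<subseteq> A" by (intro hull_minimal) auto
  then have "\<forall>i. coeff p i \<in> A" if "\<forall>i. coeff p i \<in> subalgebra hull S" for p using that by blast
  then show "adjoin (subalgebra hull S) s \<subseteq> A"
    using poly_mem_subalgebra[OF A(2)] A(1) by (auto simp: adjoin_def)
qed

lemma noetherian_finitely_generated_algebra:
  assumes "finitely_generated_algebra (A :: 'k::field ratfun set)"
  shows "noetherian A"
proof -
  have "noetherian (subalgebra hull S)" if "finite S" for S :: "'k ratfun set"
    using that
  proof (induction S rule: finite_induct)
    case empty
    have "subalgebra (range (const :: 'k \<Rightarrow> _))"
      unfolding subalgebra_def by (auto simp flip: const_simps)
    then have eq: "subalgebra hull {} = range (const :: 'k \<Rightarrow> _)"
      by (intro hull_unique) (auto simp: subalgebra_def)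
    show ?case unfolding eq
    proof (rule noetherian_subfield)
      show "is_subring (range (const :: 'k \<Rightarrow> _))"
        using \<open>subalgebra (range const)\<close> by (rule is_subring_subalgebra)
    qed (auto simp flip: const_inverse)
  next
    case (insert s S)
    then show ?case
      using hilbert_basis[OF is_subring_subalgebra[OF subalgebra_hull]] by (simp add: subalgebra_hull_insert)
  qed
  then show ?thesis using assms by (auto simp: finitely_generated_algebra_def)
qed

lemma subalgebra_finitely_generated:
  "finitely_generated_algebra A \<Longrightarrow> subalgebra A"
  using subalgebra_hull by (auto simp: finitely_generated_algebra_def)

section \<open>Localization at a prime ideal\<close>

lemma prime_ideal_ofD:
  assumes "prime_ideal_of R Q"
  shows "submodule_over R Q" "Q \<subseteq> R" "1 \<notin> Q" "0 \<in> Q"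
    "a \<in> R \<Longrightarrow> b \<in> R \<Longrightarrow> a * b \<in> Q \<Longrightarrow> a \<in> Q \<or> b \<in> Q"
  using assms submodule_overD(1) by (auto simp: prime_ideal_of_def)

lemma prime_complement_mult:
  assumes "is_subring R" "prime_ideal_of R Q" "a \<in> R - Q" "b \<in> R - Q"
  shows "a * b \<in> R - Q"
  using assms prime_ideal_ofD(5)[OF assms(2)] is_subringD(4)[OF assms(1)] by blast

lemma localization_props:
  fixes A :: "'k::field ratfun set"
  assumes A: "is_subring A" and Q: "prime_ideal_of A Q"
  shows "A \<subseteq> localization A Q" "is_subring (localization A Q)"
    "s \<in> A - Q \<Longrightarrow> inverse s \<in> localization A Q"
proof -
  have one: "1 \<in> A - Q" using is_subringD(2)[OF A] prime_ideal_ofD(3)[OF Q] by blast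
  show sub: "A \<subseteq> localization A Q"
  proof
    fix a assume "a \<in> A"
    then show "a \<in> localization A Q"
      unfolding localization_def using one by (intro CollectI exI[of _ a] exI[of _ 1]) auto
  qed
  show "s \<in> A - Q \<Longrightarrow> inverse s \<in> localization A Q"
    unfolding localization_def using one
    by (intro CollectI exI[of _ 1] exI[of _ s]) (auto simp: divide_inverse)
  have "x - y \<in> localization A Q \<and> x * y \<in> localization A Q"
    if xy: "x \<in> localization A Q" "y \<in> localization A Q" for x y
  proof -
    obtain a s where a: "x = a / s" "a \<in> A" "s \<in> A - Q" using xy(1) unfolding localization_def by blast
    obtain b t where b: "y = b / t" "b \<in> A" "t \<in> A - Q" using xy(2) unfolding localization_def by blast
    have nz: "s \<noteq> 0" "t \<noteq> 0" using a(3) b(3) prime_ideal_ofD(4)[OF Q] by auto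
    have st: "s * t \<in> A - Q" using prime_complement_mult[OF A Q a(3) b(3)] .
    have "x - y = (a * t - b * s) / (s * t)" "x * y = (a * b) / (s * t)"
      using nz by (simp_all add: a(1) b(1) field_simps)
    moreover have "a * t - b * s \<in> A" "a * b \<in> A"
      using a b is_subringD(3,4)[OF A] by auto
    ultimately show ?thesis using st unfolding localization_def by blast
  qed
  then show "is_subring (localization A Q)"
    using sub one by (auto simp: is_subring_def)
qed

text \<open>Clearing one denominator moves any element of \<open>I\<close> into
  \<open>I \<inter> A\<close>, so generators of this contraction over \<open>A\<close> generate
  \<open>I\<close> over the localization.\<close>

lemma noetherian_localization:
  fixes A :: "'k::field ratfun set"
  assumes A: "is_subring A" and Q: "prime_ideal_of A Q" and noeth: "noetherian A"
  shows "noetherian (localization A Q)"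
  unfolding noetherian_def
proof (intro allI impI)
  let ?R = "localization A Q"
  note R = localization_props[OF A Q]
  fix I assume I: "submodule_over ?R I \<and> I \<subseteq> ?R"
  note I_sub = submodule_overD[OF conjunct1[OF I]]
  have "submodule_over A (I \<inter> A)"
    unfolding submodule_over_def using I_sub R(1) is_subringD(1,4,6)[OF A] by auto
  then obtain F where F: "finite F" "F \<subseteq> I \<inter> A" "I \<inter> A \<subseteq> span_over A F"
    by (rule noetherianD[OF noeth]) auto
  have "span_over A F \<subseteq> span_over ?R F"
    using span_over_superset submodule_over_subset[OF submodule_over_span R(1)]
    by (intro span_over_minimal)
  have "x \<in> span_over ?R F" if "x \<in> I" for x
  proof -
    have "x \<in> ?R" using I that by blast
    then obtain a s where x: "x = a / s" "a \<in> A" "s \<in> A - Q" unfolding localization_def by blast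
    then have "s \<noteq> 0" using prime_ideal_ofD(4)[OF Q] by auto
    then have "a = s * x" using x by simp
    then have "a \<in> I" using I_sub(3)[of s x] that R(1) x(3) by auto
    then have "a \<in> span_over ?R F" using F(3) x(2) \<open>span_over A F \<subseteq> span_over ?R F\<close> by blast
    then have "inverse s * a \<in> span_over ?R F"
      using submodule_overD(3)[OF submodule_over_span] R(3)[OF x(3)] by blast
    then show ?thesis using x(1) by (simp add: field_simps)
  qed
  then show "\<exists>F. finite F \<and> F \<subseteq> I \<and> I \<subseteq> span_over ?R F" using F(1,2) by blast
qed

section \<open>Prime divisors are discrete valuation rings\<close>

text \<open>Values are integers without infinity, so \<open>v 0\<close> is meaningless and every
  axiom is guarded. The element of value 1 normalizes \<open>v\<close>, which makes it comparable
  with \<open>valuation\<close>.\<close>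

locale discrete_valuation =
  fixes v :: "'k::field ratfun \<Rightarrow> int"
  assumes mult: "f \<noteq> 0 \<Longrightarrow> g \<noteq> 0 \<Longrightarrow> v (f * g) = v f + v g"
    and add_ge: "f \<noteq> 0 \<Longrightarrow> g \<noteq> 0 \<Longrightarrow> f + g \<noteq> 0 \<Longrightarrow> min (v f) (v g) \<le> v (f + g)"
    and uniformizer: "\<exists>t. t \<noteq> 0 \<and> v t = 1"
    and const_eq: "c \<noteq> 0 \<Longrightarrow> v (const c) = 0"

definition valuation_ring_of :: "('k::field ratfun \<Rightarrow> int) \<Rightarrow> 'k ratfun set" where
  "valuation_ring_of v = {f. f = 0 \<or> 0 \<le> v f}"

text \<open>The module \<open>R[z] f\<close> lies in \<open>R\<close>, hence is finitely generated, hence \<open>z\<close> is integral.\<close>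

lemma stabilizer_integral:
  fixes R :: "'k::field ratfun set"
  assumes sub: "is_subring R" and noeth: "noetherian R" and int: "integrally_closed R"
    and f: "f \<in> R" "f \<noteq> 0" and z: "\<And>n. z ^ n * f \<in> R"
  shows "z \<in> R"
proof -
  note R = is_subringD[OF sub]
  \<comment> \<open>The factor \<open>f\<close> turns the modules
    \<open>R + R z + ... + R z^(n-1)\<close> into ideals of \<open>R\<close>, to which the chain
    condition applies.\<close>
  define I where "I n = {poly p z * f | p. (\<forall>i. coeff p i \<in> R) \<and> (\<forall>i\<ge>n. coeff p i = 0)}" for n
  have mem: "poly p z * f \<in> R" if "\<forall>i. coeff p i \<in> R" for p
  proof -
    have "poly p z * f = (\<Sum>i\<le>degree p. coeff p i * (z ^ i * f))"
      by (simp add: poly_altdef sum_distrib_right mult.assoc)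
    then show ?thesis using that z R(4) by (auto intro!: is_subring_sum[OF sub])
  qed
  have "submodule_over R (I n) \<and> I n \<subseteq> R" for n
  proof (intro conjI)
    show "I n \<subseteq> R" using mem by (auto simp: I_def)
    show "submodule_over R (I n)"
      unfolding submodule_over_def
    proof (intro conjI ballI)
      show "0 \<in> I n" using R(1) by (auto simp: I_def intro!: exI[of _ 0])
    next
      fix x y assume "x \<in> I n" "y \<in> I n"
      then obtain p q where "\<forall>i. coeff p i \<in> R" "\<forall>i. coeff q i \<in> R" "\<forall>i\<ge>n. coeff p i = 0"
        "\<forall>i\<ge>n. coeff q i = 0" "x = poly p z * f" "y = poly q z * f" unfolding I_def by blast
      then show "x + y \<in> I n" using R(6) by (auto simp: I_def distrib_right intro!: exI[of _ "p + q"])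
    next
      fix r x assume "r \<in> R" "x \<in> I n"
      then obtain p where "\<forall>i. coeff p i \<in> R" "\<forall>i\<ge>n. coeff p i = 0" "x = poly p z * f"
        unfolding I_def by blast
      then show "r * x \<in> I n" using R(4) \<open>r \<in> R\<close> by (auto simp: I_def intro!: exI[of _ "smult r p"])
    qed
  qed
  moreover have "I n \<subseteq> I (Suc n)" for n by (auto simp: I_def)
  ultimately obtain N where N: "\<And>n. n \<ge> N \<Longrightarrow> I n = I N"
    using noetherian_ascending_chain[of R I, OF noeth] by blast
  have "z ^ N * f \<in> I (Suc N)"
    using R(1,2) by (auto simp: I_def poly_monom intro!: exI[of _ "monom 1 N"])
  then have "z ^ N * f \<in> I N" using N[of "Suc N"] by simp
  then obtain p where p: "\<forall>i. coeff p i \<in> R" "\<forall>i\<ge>N. coeff p i = 0" "z ^ N * f = poly p z * f"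
    unfolding I_def by blast
  \<comment> \<open>Stabilization writes \<open>z^N f\<close> through lower powers of
    \<open>z\<close>; cancelling \<open>f\<close> leaves a monic equation for
    \<open>z\<close>.\<close>
  let ?q = "monom 1 N - p"
  have coeff: "coeff ?q N = 1" "\<forall>i>N. coeff ?q i = 0" using p(2) by auto
  then have "degree ?q = N" by (intro antisym degree_le le_degree) auto
  then have "lead_coeff ?q = 1" using coeff by simp
  moreover have "coeff ?q i \<in> R" for i using p(1) R(1,2,3,5) by (auto simp: coeff_monom)
  moreover have "poly ?q z = 0" using p(3) f(2) by (simp add: poly_monom)
  ultimately show ?thesis using int unfolding integrally_closed_def by blast
qed

text \<open>The maximal ideal is an associated prime of \<open>R / f R\<close>. Among the
  annihilators \<open>C y\<close> of nonzero classes a largest one is prime, and it contains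
  \<open>f\<close>, hence is not the zero ideal.\<close>

lemma exists_colon_maximal_ideal:
  fixes R :: "'k::field ratfun set"
  assumes sub: "is_subring R" and noeth: "noetherian R"
    and primes: "{Q. prime_ideal_of R Q} = {{0}, \<mm>}" and f: "f \<in> R" "f \<noteq> 0" "inverse f \<notin> R"
  obtains y where "y \<in> R" "y / f \<notin> R" "\<And>x. x \<in> \<mm> \<Longrightarrow> y / f * x \<in> R"
proof -
  note R = is_subringD[OF sub]
  define C where "C y = {r \<in> R. y / f * r \<in> R}" for y
  let ?\<F> = "{C y | y. y \<in> R \<and> y / f \<notin> R}"
  have ideal: "submodule_over R (C y) \<and> C y \<subseteq> R" for y
    unfolding submodule_over_def C_def using R
    by (auto simp: distrib_left mult.left_commute[of "y / f"] simp del: times_divide_eq_left)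
  have "C 1 \<in> ?\<F>" using R(2) f(3) by (auto simp: divide_inverse)
  then obtain M where "M \<in> ?\<F>" and max: "\<forall>I\<in>?\<F>. M \<subseteq> I \<longrightarrow> I = M"
    using noetherian_maximal_ideal[OF noeth, of ?\<F>] ideal by blast
  then obtain y where y: "y \<in> R" "y / f \<notin> R" "M = C y" by blast
  have "prime_ideal_of R M"
    unfolding prime_ideal_of_def
  proof (intro conjI ballI impI)
    show "submodule_over R M" "M \<subseteq> R" using ideal y(3) by auto
    show "1 \<notin> M" using y by (simp add: C_def)
    fix a b assume ab: "a \<in> R" "b \<in> R" "a * b \<in> M"
    show "a \<in> M \<or> b \<in> M"
    proof (cases "b \<in> M")
      case False
      \<comment> \<open>Since \<open>b\<close> does not annihilate the class of \<open>y\<close>,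
        the class of \<open>y b\<close> is nonzero. Its annihilator contains \<open>M\<close>, so
        maximality gives equality.\<close>
      then have "C (y * b) \<in> ?\<F>" using ab(2) y R(4) by (auto simp: C_def)
      moreover have "M \<subseteq> C (y * b)"
      proof
        fix r assume "r \<in> M"
        then have r: "r \<in> R" "y / f * r \<in> R" using y(3) by (auto simp: C_def)
        from r(1) R(4)[OF r(2) ab(2)] show "r \<in> C (y * b)" by (simp add: C_def mult_ac)
      qed
      ultimately have "C (y * b) = M" using max by blast
      moreover have "a \<in> C (y * b)" using ab y(3) by (simp add: C_def mult_ac)
      ultimately show ?thesis by blast
    qed simp
  qed
  moreover have "f \<in> M" using f y(1,3) by (simp add: C_def)
  ultimately have "M = \<mm>" using primes f(2) by blast
  then show thesis using that y unfolding C_def by blast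
qed

text \<open>The fraction \<open>z = y / f\<close> multiplies the maximal ideal into \<open>R\<close>
  without lying in \<open>R\<close>. If it preserved the maximal ideal it would be integral, hence
  in \<open>R\<close> by normality. So \<open>z t\<close> is a unit for some \<open>t\<close> in the
  maximal ideal, and such a \<open>t\<close> is a generator.\<close>

lemma maximal_ideal_principal:
  fixes R :: "'k::field ratfun set"
  assumes sub: "is_subring R" and noeth: "noetherian R" and int: "integrally_closed R"
    and ne: "max_ideal R \<noteq> {0}" and primes: "{Q. prime_ideal_of R Q} = {{0}, max_ideal R}"
  obtains t where "t \<in> R" "t \<noteq> 0" "max_ideal R = {r * t | r. r \<in> R}"
proof -
  note R = is_subringD[OF sub]
  have "prime_ideal_of R (max_ideal R)" using primes by blast
  note m = prime_ideal_ofD[OF this] and m_sub = submodule_overD[OF prime_ideal_ofD(1)[OF this]]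
  obtain f where f: "f \<in> max_ideal R" "f \<noteq> 0" using ne m(4) by blast
  then have fR: "f \<in> R" "inverse f \<notin> R" by (auto simp: max_ideal_def)
  obtain y where y: "y \<in> R" "y / f \<notin> R" "\<And>x. x \<in> max_ideal R \<Longrightarrow> y / f * x \<in> R"
    using exists_colon_maximal_ideal[OF sub noeth primes fR(1) f(2) fR(2)] by blast
  define z where "z = y / f"
  have "\<exists>x\<in>max_ideal R. z * x \<notin> max_ideal R"
  proof (rule ccontr)
    assume "\<not> ?thesis"
    then have "z ^ n * f \<in> max_ideal R" for n
      using f(1) by (induction n) (auto simp: mult.assoc)
    then have "z ^ n * f \<in> R" for n using m(2) by blast
    then have "z \<in> R" using stabilizer_integral[OF sub noeth int fR(1) f(2)] by blast
    then show False using y(2) by (simp add: z_def)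
  qed
  then obtain t where t: "t \<in> max_ideal R" "z * t \<notin> max_ideal R" by blast
  have zt: "z * t \<in> R" using y(3) t(1) by (simp add: z_def)
  then have unit: "z * t \<noteq> 0" "inverse (z * t) \<in> R" using t(2) by (auto simp: max_ideal_def)
  have "max_ideal R = {r * t | r. r \<in> R}"
  proof
    show "{r * t | r. r \<in> R} \<subseteq> max_ideal R" using m_sub(3) t(1) by blast
    show "max_ideal R \<subseteq> {r * t | r. r \<in> R}"
    proof
      fix x assume "x \<in> max_ideal R"
      then have "z * x * inverse (z * t) \<in> R" using R(4)[OF y(3) unit(2)] by (simp add: z_def)
      moreover have "x = z * x * inverse (z * t) * t" using unit(1) by (simp add: field_simps)
      ultimately show "x \<in> {r * t | r. r \<in> R}" by blast
    qed
  qed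
  then show thesis using that[of t] t(1) m(2) unit(1) by auto
qed

text \<open>Otherwise \<open>f\<close> would be divisible by every power of \<open>t\<close>; the
  ascending ideals \<open>R (f / t^n)\<close> would stabilize, and this makes \<open>t\<close> a
  unit.\<close>

lemma unit_times_power_exists:
  fixes R :: "'k::field ratfun set"
  assumes sub: "is_subring R" and noeth: "noetherian R"
    and t: "t \<in> R" "t \<noteq> 0" "max_ideal R = {r * t | r. r \<in> R}" and f: "f \<in> R" "f \<noteq> 0"
  shows "\<exists>n u. u \<in> R - max_ideal R \<and> f = u * t ^ n"
proof (rule ccontr)
  assume contra: "\<not> ?thesis"
  note R = is_subringD[OF sub]
  have "1 \<notin> max_ideal R" using R(2) by (simp add: max_ideal_def)
  have div: "f / t ^ n \<in> R" for n
  proof (induction n)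
    case (Suc n)
    have "f = f / t ^ n * t ^ n" using t(2) by simp
    then have "f / t ^ n \<in> max_ideal R" using contra Suc by blast
    then obtain r where "r \<in> R" "f / t ^ n = r * t" using t(3) by blast
    then have "f / t ^ Suc n = r" using t(2) by (simp add: field_simps)
    then show ?case using \<open>r \<in> R\<close> by simp
  qed (use f in simp)
  define I where "I n = {r * (f / t ^ n) | r. r \<in> R}" for n
  have "submodule_over R (I n) \<and> I n \<subseteq> R" for n
    using submodule_over_principal[OF sub, of "f / t ^ n"] R(4)[OF _ div[of n]] by (auto simp: I_def)
  moreover have "I n \<subseteq> I (Suc n)" for n
  proof
    fix x assume "x \<in> I n"
    then obtain r where "r \<in> R" "x = r * (f / t ^ n)" unfolding I_def by blast
    then have "x = (r * t) * (f / t ^ Suc n)" "r * t \<in> R" using t R(4) by auto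
    then show "x \<in> I (Suc n)" unfolding I_def by blast
  qed
  ultimately obtain N where N: "\<And>n. n \<ge> N \<Longrightarrow> I n = I N"
    using noetherian_ascending_chain[of R I, OF noeth] by blast
  have "I (Suc N) = I N" by (rule N) simp
  moreover have "f / t ^ Suc N \<in> I (Suc N)" unfolding I_def using R(2) by force
  ultimately obtain r where r: "r \<in> R" "f / t ^ Suc N = r * (f / t ^ N)" unfolding I_def by blast
  then have "r * t = 1" using f(2) t(2) by (simp add: field_simps)
  then have "1 \<in> max_ideal R" using t(3) r(1) by force
  then show False using \<open>1 \<notin> max_ideal R\<close> by blast
qed

lemma fraction_cases:
  fixes x :: "'k::field ratfun"
  obtains a b where "b \<noteq> 0" "x = to_fract a / to_fract b"
  by (cases x) (auto simp: Fract_conv_to_fract)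

text \<open>Because \<open>R\<close> contains the polynomials, numerators and denominators of all
  rational functions lie in \<open>R\<close>, so each nonzero function is a unit times an integral
  power of \<open>t\<close>. The valuation is this exponent.\<close>

theorem discrete_valuation_of_principal:
  fixes R :: "'k::field ratfun set"
  assumes alg: "subalgebra R" and noeth: "noetherian R" and plane: "range to_fract \<subseteq> R"
    and t: "t \<in> R" "t \<noteq> 0" "max_ideal R = {r * t | r. r \<in> R}"
  obtains v where "discrete_valuation v" "R = valuation_ring_of v"
proof -
  have sub: "is_subring R" by (rule is_subring_subalgebra[OF alg])
  note R = is_subringD[OF sub]
  have plane: "to_fract a \<in> R" for a using plane by blast
  define U where "U = R - max_ideal R"
  have U: "u \<in> U \<longleftrightarrow> u \<in> R \<and> u \<noteq> 0 \<and> inverse u \<in> R" for u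
    by (auto simp: U_def max_ideal_def)
  have U_mult: "u * w \<in> U" if "u \<in> U" "w \<in> U" for u w using that R(4) by (auto simp: U)
  have U_inv: "inverse u \<in> U" if "u \<in> U" for u using that by (auto simp: U)
  have "t \<in> max_ideal R" unfolding t(3) using R(2) by force
  then have t_inv: "inverse t \<notin> R" using t(2) by (simp add: max_ideal_def)
  \<comment> \<open>Two different exponents would make a positive power of \<open>t\<close>, hence
    \<open>t\<close> itself, invertible in \<open>R\<close>.\<close>
  have unique: "m \<le> n" if "u \<in> U" "w \<in> U" "u * t powi m = w * t powi n" for u w m n
  proof (rule ccontr)
    assume "\<not> m \<le> n"
    then obtain k where k: "m = n + int (Suc k)" using zless_iff_Suc_zadd[of n m] by auto
    have "u * t powi m = u * t ^ Suc k * t powi n"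
      unfolding k using t(2) by (simp add: power_int_add del: power_Suc of_nat_Suc)
    from this[symmetric] that(3) have "u * t ^ Suc k * t powi n = w * t powi n" by (rule trans)
    then have "u * t ^ Suc k = w" using t(2) by auto
    then have "inverse t = u * t ^ k * inverse w"
      using t(2) that(2) by (auto simp: U field_simps)
    then have "inverse t \<in> R" using that(1,2) R(4,7) t(1) by (auto simp: U)
    then show False using t_inv by blast
  qed
  have unique_eq: "m = n" if "u \<in> U" "w \<in> U" "u * t powi m = w * t powi n" for u w m n
    using unique[OF that] unique[OF that(2,1) that(3)[symmetric]] by simp
  have ex_int: "\<exists>n u. u \<in> U \<and> f = u * t powi n" if "f \<noteq> 0" for f
  proof -
    obtain a b where ab: "b \<noteq> 0" "f = to_fract a / to_fract b" by (rule fraction_cases)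
    then have "a \<noteq> 0" using that by auto
    obtain i u where u: "u \<in> U" "to_fract a = u * t ^ i"
      using unit_times_power_exists[OF sub noeth t plane[of a]] \<open>a \<noteq> 0\<close> by (auto simp: U_def)
    obtain j w where w: "w \<in> U" "to_fract b = w * t ^ j"
      using unit_times_power_exists[OF sub noeth t plane[of b]] \<open>b \<noteq> 0\<close> by (auto simp: U_def)
    have "f = (u * inverse w) * t powi (int i - int j)"
      using t(2) by (simp add: ab(2) u(2) w(2) power_int_diff field_simps)
    then show ?thesis using U_mult[OF u(1) U_inv[OF w(1)]] by blast
  qed
  define v where "v f = (THE n. \<exists>u\<in>U. f = u * t powi n)" for f
  have v_eq: "v (u * t powi n) = n" if "u \<in> U" for u n
    unfolding v_def using that unique_eq by (intro the_equality) blast+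
  have R_iff: "u * t powi n \<in> R \<longleftrightarrow> 0 \<le> n" if "u \<in> U" for u n
  proof
    assume "0 \<le> n"
    then have "t powi n \<in> R" using R(7)[OF t(1)] by (simp add: power_int_def)
    then show "u * t powi n \<in> R" using that R(4) by (simp add: U)
  next
    assume mem: "u * t powi n \<in> R"
    show "0 \<le> n"
    proof (rule ccontr)
      assume "\<not> 0 \<le> n"
      then obtain k where k: "n = - int (Suc k)"
        by (metis not_le zero_le_imp_eq_int zero_less_imp_eq_int neg_0_less_iff_less add.inverse_inverse gr0_implies_Suc)
      have "inverse t = inverse u * (u * t powi n) * t ^ k"
        unfolding k using that t(2) by (simp add: U power_int_minus field_simps del: of_nat_Suc)
      then have "inverse t \<in> R" using mem that R(4,7) t(1) by (auto simp: U)
      then show False using t_inv by blast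
    qed
  qed
  have R_eq: "R = valuation_ring_of v"
  proof (rule Set.set_eqI)
    fix f show "f \<in> R \<longleftrightarrow> f \<in> valuation_ring_of v"
    proof (cases "f = 0")
      case False
      then obtain n u where "u \<in> U" "f = u * t powi n" using ex_int by blast
      then show ?thesis using R_iff v_eq False t(2) by (simp add: valuation_ring_of_def)
    qed (simp add: valuation_ring_of_def R(1))
  qed
  have "discrete_valuation v"
  proof
    fix f g :: "'k ratfun" assume nz: "f \<noteq> 0" "g \<noteq> 0"
    obtain m u where u: "u \<in> U" "f = u * t powi m" using ex_int nz by blast
    obtain n w where w: "w \<in> U" "g = w * t powi n" using ex_int nz by blast
    have fg: "f * g = (u * w) * t powi (m + n)" using t(2) by (simp add: u(2) w(2) power_int_add)
    show "v (f * g) = v f + v g"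
      unfolding fg v_eq[OF U_mult[OF u(1) w(1)]] by (simp add: u(2) w(2) v_eq u(1) w(1))
    assume "f + g \<noteq> 0"
    then obtain k x where x: "x \<in> U" "f + g = x * t powi k" using ex_int by blast
    \<comment> \<open>Dividing the sum by \<open>t powi l\<close> leaves an element of
      \<open>R\<close>, and membership in \<open>R\<close> is the same as a non-negative
      exponent.\<close>
    define l where "l = min m n"
    have "t powi (m - l) \<in> R" "t powi (n - l) \<in> R"
      using R(7)[OF t(1)] by (auto simp: power_int_def l_def)
    then have "u * t powi (m - l) + w * t powi (n - l) \<in> R"
      using u(1) w(1) R(4,6) by (auto simp: U)
    moreover have "(u * t powi m + w * t powi n) / t powi l = x * t powi k / t powi l"
      using x(2) by (simp add: u(2) w(2))
    then have "u * t powi (m - l) + w * t powi (n - l) = x * t powi (k - l)"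
      using t(2) by (simp add: power_int_diff add_divide_distrib)
    ultimately have "0 \<le> k - l" using R_iff[OF x(1)] by simp
    then show "min (v f) (v g) \<le> v (f + g)"
      unfolding x(2) v_eq[OF x(1)] by (simp add: u(2) w(2) v_eq u(1) w(1) l_def)
  next
    have "1 \<in> U" using R(2) by (simp add: U)
    then have "v t = 1" using v_eq[of 1 1] by simp
    then show "\<exists>t. t \<noteq> 0 \<and> v t = 1" using t(2) by blast
  next
    fix c :: 'k assume "c \<noteq> 0"
    have "const c \<in> U"
      using alg \<open>c \<noteq> 0\<close> by (auto simp: U subalgebra_def simp flip: const_inverse)
    then show "v (const c) = 0" using v_eq[of "const c" 0] by simp
  qed
  then show thesis using that R_eq by blast
qed

text \<open>The chart supplies the Noetherian property through localization, and normality of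
  \<open>Y\<close> supplies integral closedness. From here on a divisor is used only through its
  valuation.\<close>

theorem divisor_is_valuation_ring:
  fixes E :: "'k::field ratfun set"
  assumes "E \<in> divisors_over_plane"
  obtains v where "discrete_valuation v" "E = valuation_ring_of v" "range to_fract \<subseteq> E"
proof -
  obtain Y where Y: "birational_over_plane Y" "normal_variety Y" "E \<in> prime_divisors Y"
    using assms by (auto simp: divisors_over_plane_def)
  then have E: "E \<in> Y" "max_ideal E \<noteq> {0}" "{Q. prime_ideal_of E Q} = {{0}, max_ideal E}"
    by (auto simp: prime_divisors_def)
  obtain \<A> where "\<forall>A\<in>\<A>. finitely_generated_algebra A \<and> range to_fract \<subseteq> A" "Y = (\<Union>A\<in>\<A>. local_rings A)"
    using Y(1) unfolding birational_over_plane_def by blast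
  then obtain A where A: "finitely_generated_algebra A" "range to_fract \<subseteq> A" "E \<in> local_rings A"
    using E(1) by blast
  then obtain Q where Q: "prime_ideal_of A Q" "E = localization A Q" by (auto simp: local_rings_def)
  note alg = subalgebra_finitely_generated[OF A(1)]
  note sub = is_subring_subalgebra[OF alg]
  note loc = localization_props[OF sub Q(1), folded Q(2)]
  have noeth: "noetherian E"
    using noetherian_localization[OF sub Q(1) noetherian_finitely_generated_algebra[OF A(1)]] Q(2) by simp
  have "range const \<subseteq> E" using alg loc(1) by (auto simp: subalgebra_def)
  then have "subalgebra E" using is_subringD(4,6)[OF loc(2)] by (auto simp: subalgebra_def)
  moreover have "range to_fract \<subseteq> E" using A(2) loc(1) by blast
  moreover have "integrally_closed E" using Y(2) E(1) by (simp add: normal_variety_def)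
  then obtain t where "t \<in> E" "t \<noteq> 0" "max_ideal E = {r * t | r. r \<in> E}"
    using maximal_ideal_principal[OF loc(2) noeth _ E(2,3)] by blast
  ultimately show thesis
    using discrete_valuation_of_principal[OF _ noeth] that by blast
qed

section \<open>Derivations of the function field\<close>

locale derivation =
  fixes D :: "'k::field ratfun \<Rightarrow> 'k ratfun"
  assumes add: "D (f + g) = D f + D g"
    and mult: "D (f * g) = f * D g + g * D f"
    and const: "D (const c) = 0"
begin

lemma zero [simp]: "D 0 = 0" and one [simp]: "D 1 = 0"
  using const[of 0] const[of 1] by simp_all

lemma uminus: "D (- f) = - D f"
  using add[of f "- f"] by (simp add: eq_neg_iff_add_eq_0 add.commute)

lemma diff: "D (f - g) = D f - D g"
  using add[of f "- g"] by (simp add: uminus)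

lemma inverse: "f \<noteq> 0 \<Longrightarrow> D (inverse f) = - D f / f\<^sup>2"
proof -
  assume "f \<noteq> 0"
  have "f * D (inverse f) + inverse f * D f = 0" using mult[of f "inverse f"] \<open>f \<noteq> 0\<close> by simp
  then have "f * D (inverse f) = - (inverse f * D f)" by (simp only: eq_neg_iff_add_eq_0)
  moreover have "D (inverse f) = inverse f * (f * D (inverse f))" using \<open>f \<noteq> 0\<close> by simp
  ultimately have "D (inverse f) = inverse f * - (inverse f * D f)" by metis
  then show ?thesis by (simp add: divide_inverse power2_eq_square mult_ac)
qed

lemma divide: "g \<noteq> 0 \<Longrightarrow> D (f / g) = (D f * g - f * D g) / g\<^sup>2"
proof -
  assume "g \<noteq> 0"
  have "D (f / g) = f * (- D g / g\<^sup>2) + inverse g * D f"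
    using mult[of f "inverse g"] inverse[OF \<open>g \<noteq> 0\<close>] by (simp add: divide_inverse)
  also have "\<dots> = (D f * g - f * D g) / g\<^sup>2"
    using \<open>g \<noteq> 0\<close> by (simp add: field_simps power2_eq_square)
  finally show ?thesis .
qed

lemma power: "D (f ^ n) = of_nat n * f ^ (n - 1) * D f"
proof (induction n)
  case (Suc n)
  have "f * D (f ^ n) = of_nat n * f ^ n * D f" unfolding Suc by (cases n) simp_all
  then show ?case using mult[of f "f ^ n"] by (simp add: distrib_right)
qed simp

lemma power_int:
  assumes "f \<noteq> 0"
  shows "D (f powi n) = of_int n * f powi (n - 1) * D f"
proof (cases n rule: int_cases)
  case (nonneg m)
  then show ?thesis
  proof (cases m)
    case (Suc k)
    have "f powi n = f ^ m" "f powi (n - 1) = f ^ k" "of_int n = (of_nat m :: 'k ratfun)"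
      using Suc by (simp_all add: nonneg power_int_def nat_add_distrib)
    then show ?thesis using power[of f m] Suc by simp
  qed (use nonneg in simp)
next
  case (neg m)
  have "D (inverse (f ^ Suc m)) = - (of_nat (Suc m) * f ^ m * D f) / (f ^ Suc m)\<^sup>2"
    using inverse[of "f ^ Suc m"] power[of f "Suc m"] assms by simp
  also have "(f ^ Suc m)\<^sup>2 = f ^ m * f ^ Suc (Suc m)" by (simp add: power2_eq_square mult_ac)
  also have "- (of_nat (Suc m) * f ^ m * D f) / (f ^ m * f ^ Suc (Suc m))
      = - of_nat (Suc m) * inverse (f ^ Suc (Suc m)) * D f"
    using assms by (simp add: field_simps del: of_nat_Suc power_Suc)
  finally have "D (inverse (f ^ Suc m)) = - of_nat (Suc m) * inverse (f ^ Suc (Suc m)) * D f" .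
  moreover have "f powi n = inverse (f ^ Suc m)"
    unfolding neg by (simp only: power_int_minus power_int_of_nat)
  moreover have "n - 1 = - int (Suc (Suc m))" using neg by simp
  then have "f powi (n - 1) = inverse (f ^ Suc (Suc m))"
    by (simp only: power_int_minus power_int_of_nat)
  moreover have "of_int n = - (of_nat (Suc m) :: 'k ratfun)" unfolding neg by simp
  ultimately show ?thesis by simp
qed

end

lemma derivation_extend:
  fixes D :: "'k::field plane \<Rightarrow> 'k plane"
  assumes add: "\<And>p q. D (p + q) = D p + D q" and mult: "\<And>p q. D (p * q) = p * D q + q * D p"
    and const: "\<And>c. D [:[:c:]:] = 0"
  shows "derivation (extend_derivation D)"
proof
  note ext = extend_derivation_Fract[of D, OF mult]
  fix f g :: "'k ratfun"
  obtain a b where ab: "b \<noteq> 0" "f = Fract a b" by (cases f)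
  obtain c d where cd: "d \<noteq> 0" "g = Fract c d" by (cases g)
  show "extend_derivation D (f + g) = extend_derivation D f + extend_derivation D g"
    using ab(1) cd(1) by (simp add: ab(2) cd(2) ext eq_fract add mult) (simp add: algebra_simps)
  show "extend_derivation D (f * g) = f * extend_derivation D g + g * extend_derivation D f"
    using ab(1) cd(1) by (simp add: ab(2) cd(2) ext eq_fract mult) (simp add: algebra_simps)
next
  fix c :: 'k
  have "D 1 = 0" using const[of 1] by simp
  then show "extend_derivation D (const c) = 0"
    using extend_derivation_Fract[of D 1 "[:[:c:]:]", OF mult] const
    by (simp add: const_def to_fract_def Zero_fract_def eq_fract)
qed

interpretation d1: derivation partial_x1
  unfolding partial_x1_def
proof (rule derivation_extend)
  show "map_poly pderiv (p + q) = map_poly pderiv p + map_poly pderiv (q :: 'a plane)" for p q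
    by (simp add: poly_eq_iff coeff_map_poly pderiv_add)
  show "map_poly pderiv [:[:c:]:] = 0" for c :: 'a
    by (simp add: poly_eq_iff coeff_map_poly coeff_pCons pderiv_pCons split: nat.splits)
qed (rule map_poly_pderiv_mult)

interpretation d2: derivation partial_x2
  unfolding partial_x2_def
  by (rule derivation_extend) (simp_all add: pderiv_add pderiv_mult pderiv_pCons)

lemma map_poly_pderiv_1 [simp]: "map_poly pderiv 1 = (0 :: 'k::field plane)"
  using map_poly_pderiv_mult[of 1 "1 :: 'k plane"] by (metis add_cancel_right_right mult_1)

lemma partial_to_fract:
  "partial_x1 (to_fract p) = to_fract (map_poly pderiv p)" "partial_x2 (to_fract p) = to_fract (pderiv p)"
  by (simp_all add: to_fract_def partial_Fract)

lemma partial_coords [simp]: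
  "partial_x1 (to_fract X1) = 1" "partial_x1 (to_fract X2) = 0"
  "partial_x2 (to_fract X1) = 0" "partial_x2 (to_fract X2) = 1"
  by (simp_all add: partial_to_fract X1_def X2_def map_poly_pCons pderiv_pCons)

lemma coords_nonzero [simp]: "X1 \<noteq> 0" "X2 \<noteq> 0"
  by (simp_all add: X1_def X2_def)

lemma jacobian_swap: "jacobian g f = - jacobian f g"
  by (simp add: jacobian_def algebra_simps)

lemma jacobian_self [simp]: "jacobian f f = 0"
  by (simp add: jacobian_def algebra_simps)

text \<open>Wedging with \<open>df\<close> turns the quotient, power and constant rules for
  derivations into rules for 2-forms; \<open>jacobian_swap\<close> carries them to the other
  slot.\<close>

lemma derivation_jacobian: "derivation (jacobian f)"
  by standard (simp_all add: jacobian_def d1.add d2.add d1.mult d2.mult d1.const d2.const algebra_simps)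

section \<open>Discrete valuation rings\<close>

text \<open>The fractional ideal generated by the \<open>n\<close>-th power of a uniformizer. Zero
  is put in by hand because \<open>v 0\<close> carries no information.\<close>

definition val_ge :: "('k::field ratfun \<Rightarrow> int) \<Rightarrow> int \<Rightarrow> 'k ratfun set" where
  "val_ge v n = {f. f = 0 \<or> n \<le> v f}"

lemma valuation_ring_of_eq: "valuation_ring_of v = val_ge v 0"
  by (simp add: valuation_ring_of_def val_ge_def)

context discrete_valuation
begin

abbreviation "Ov \<equiv> val_ge v 0"

lemma one [simp]: "v 1 = 0"
  using mult[of 1 1] by simp

lemma uminus: "v (- f) = v f"
proof (cases "f = 0")
  case False
  then have "v (const (-1) * f) = v f" using mult[of "const (-1)" f] const_eq[of "-1"] by simp
  then show ?thesis by simp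
qed simp

lemma inverse: "f \<noteq> 0 \<Longrightarrow> v (inverse f) = - v f"
  using mult[of f "inverse f"] by simp

lemma divide: "f \<noteq> 0 \<Longrightarrow> g \<noteq> 0 \<Longrightarrow> v (f / g) = v f - v g"
  by (simp add: divide_inverse mult inverse)

lemma power: "f \<noteq> 0 \<Longrightarrow> v (f ^ n) = int n * v f"
  by (induction n) (simp_all add: mult algebra_simps)

lemma power_int: "f \<noteq> 0 \<Longrightarrow> v (f powi n) = n * v f"
  by (cases n rule: int_cases) (simp_all add: power power_int_minus inverse del: of_nat_Suc power_Suc)

lemma add_eq:
  assumes "f \<noteq> 0" "g \<noteq> 0" "v f < v g"
  shows "f + g \<noteq> 0" "v (f + g) = v f"
proof -
  show nz: "f + g \<noteq> 0" using assms(3) uminus[of f] by (auto simp: add_eq_0_iff)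
  show "v (f + g) = v f"
    \<comment> \<open>The second instance, \<open>(f + g) + (- g) = f\<close>, rules out a value of
      \<open>f + g\<close> above \<open>v f\<close>.\<close>
    using add_ge[OF assms(1,2) nz] add_ge[of "f + g" "- g"] nz assms uminus[of g] by auto
qed

lemma val_ge_add: "f \<in> val_ge v n \<Longrightarrow> g \<in> val_ge v n \<Longrightarrow> f + g \<in> val_ge v n"
  using add_ge[of f g] unfolding val_ge_def by fastforce

lemma val_ge_mult: "f \<in> val_ge v m \<Longrightarrow> g \<in> val_ge v n \<Longrightarrow> f * g \<in> val_ge v (m + n)"
  by (cases "f = 0"; cases "g = 0") (auto simp: val_ge_def mult)

lemma val_ge_uminus: "f \<in> val_ge v n \<Longrightarrow> - f \<in> val_ge v n"
  by (simp add: val_ge_def uminus)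

lemma val_ge_diff: "f \<in> val_ge v n \<Longrightarrow> g \<in> val_ge v n \<Longrightarrow> f - g \<in> val_ge v n"
  using val_ge_add[of f n "- g"] val_ge_uminus by simp

lemma submodule_val_ge: "submodule_over Ov (val_ge v n)"
  unfolding submodule_over_def
  using val_ge_add val_ge_mult[of _ 0 _ n] by (auto simp: val_ge_def)

lemma subalgebra_Ov: "subalgebra Ov"
proof -
  have "const c \<in> Ov" for c by (cases "c = 0") (auto simp: val_ge_def const_eq)
  then show ?thesis
    unfolding subalgebra_def using val_ge_add[of _ 0] val_ge_mult[of _ 0 _ 0] by auto
qed

lemma is_subring_Ov: "is_subring Ov"
  by (rule is_subring_subalgebra[OF subalgebra_Ov])

lemma max_ideal_Ov: "max_ideal Ov = val_ge v 1"
  by (auto simp: max_ideal_def val_ge_def inverse)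

lemma val_ge_mono: "m \<le> n \<Longrightarrow> val_ge v n \<subseteq> val_ge v m"
  by (auto simp: val_ge_def)

text \<open>A nonzero prime contains some \<open>q\<close>, hence the power \<open>t^(v q)\<close>,
  hence the uniformizer \<open>t\<close>; and it contains no unit.\<close>

lemma prime_ideals_Ov:
  "max_ideal Ov \<noteq> {0}" "{Q. prime_ideal_of Ov Q} = {{0}, max_ideal Ov}"
proof -
  obtain t where t: "t \<noteq> 0" "v t = 1" using uniformizer by blast
  then have "t \<in> max_ideal Ov" unfolding max_ideal_Ov by (simp add: val_ge_def)
  then show "max_ideal Ov \<noteq> {0}" using t(1) by blast
  have "prime_ideal_of Ov {0}" 
    unfolding prime_ideal_of_def submodule_over_def by (simp add: val_ge_def)
  moreover have "prime_ideal_of Ov (val_ge v 1)"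
    unfolding prime_ideal_of_def
  proof (intro conjI ballI impI)
    fix a b assume "a \<in> Ov" "b \<in> Ov" "a * b \<in> val_ge v 1"
    then show "a \<in> val_ge v 1 \<or> b \<in> val_ge v 1"
      by (cases "a = 0"; cases "b = 0") (auto simp: val_ge_def mult)
  qed (use submodule_val_ge[of 1] val_ge_mono[of 0 1] in \<open>simp_all add: val_ge_def\<close>)
  moreover have "Q = val_ge v 1" if Q: "prime_ideal_of Ov Q" and "Q \<noteq> {0}" for Q
  proof
    note QD = prime_ideal_ofD[OF Q] and Q_sub = submodule_overD[OF prime_ideal_ofD(1)[OF Q]]
    obtain q where q: "q \<in> Q" "q \<noteq> 0" using QD(4) \<open>Q \<noteq> {0}\<close> by blast
    show "Q \<subseteq> val_ge v 1"
    proof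
      fix x assume "x \<in> Q"
      show "x \<in> val_ge v 1"
      proof (rule ccontr)
        assume "x \<notin> val_ge v 1"
        then have "x \<noteq> 0" "inverse x \<in> Ov" by (auto simp: val_ge_def inverse)
        then have "inverse x * x \<in> Q" using Q_sub(3) \<open>x \<in> Q\<close> by blast
        then show False using QD(3) \<open>x \<noteq> 0\<close> by simp
      qed
    qed
    have root: "t \<in> Q" if "t ^ n \<in> Q" for n
      using that
    proof (induction n)
      case (Suc n)
      have "t \<in> Ov" "t ^ n \<in> Ov" using t power[of t n] by (auto simp: val_ge_def)
      then show ?case using QD(5)[of t "t ^ n"] Suc by auto
    qed (use QD(3) in simp)
    have "0 \<le> v q" using q QD(2) by (auto simp: val_ge_def)
    then have "t ^ nat (v q) / q \<in> Ov" using t q(2) by (auto simp: val_ge_def divide power)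
    then have "t ^ nat (v q) / q * q \<in> Q" using Q_sub(3) q(1) by blast
    then have "t \<in> Q" using root q(2) by simp
    show "val_ge v 1 \<subseteq> Q"
    proof
      fix x assume "x \<in> val_ge v 1"
      then have "x / t \<in> Ov" using t by (cases "x = 0") (auto simp: val_ge_def divide)
      then have "x / t * t \<in> Q" using Q_sub(3) \<open>t \<in> Q\<close> by blast
      then show "x \<in> Q" using t(1) by simp
    qed
  qed
  ultimately show "{Q. prime_ideal_of Ov Q} = {{0}, max_ideal Ov}" unfolding max_ideal_Ov by blast
qed

lemma ideal_power_Ov: "ideal_power Ov (max_ideal Ov) n = val_ge v (int n)"
proof (induction n)
  case (Suc n)
  obtain t where t: "t \<noteq> 0" "v t = 1" using uniformizer by blast
  let ?P = "{x * y | x y. x \<in> val_ge v 1 \<and> y \<in> val_ge v (int n)}"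
  have "?P \<subseteq> val_ge v (int (Suc n))" using val_ge_mult[of _ 1 _ "int n"] by (auto simp: add.commute)
  then have "span_over Ov ?P \<subseteq> val_ge v (int (Suc n))" using submodule_val_ge by (rule span_over_minimal)
  moreover have "val_ge v (int (Suc n)) \<subseteq> span_over Ov ?P"
  proof
    fix x assume "x \<in> val_ge v (int (Suc n))"
    then have "x / t \<in> val_ge v (int n)" using t by (cases "x = 0") (auto simp: val_ge_def divide)
    moreover have "t \<in> val_ge v 1" using t by (simp add: val_ge_def)
    ultimately have "t * (x / t) \<in> ?P" by blast
    then show "x \<in> span_over Ov ?P" using span_over_superset[of ?P Ov] t(1) by auto
  qed
  ultimately show ?case unfolding ideal_power.simps(2) Suc unfolding module_prod_def max_ideal_Ov by blast
qed simp

lemma order_along_span: "order_along Ov (span_over Ov S) = Sup {enat n | n. S \<subseteq> val_ge v (int n)}"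
proof -
  have "span_over Ov S \<subseteq> val_ge v m \<longleftrightarrow> S \<subseteq> val_ge v m" for m
    using span_over_minimal[OF _ submodule_val_ge[of m], of S] span_over_superset[of S Ov] by blast
  then show ?thesis unfolding order_along_def ideal_power_Ov by simp
qed

lemma order_along_ge: "S \<subseteq> val_ge v (int n) \<Longrightarrow> enat n \<le> order_along Ov (span_over Ov S)"
  unfolding order_along_span by (rule Sup_upper) blast

lemma order_along_le: "f \<in> S \<Longrightarrow> f \<noteq> 0 \<Longrightarrow> order_along Ov (span_over Ov S) \<le> enat (nat (v f))"
  unfolding order_along_span by (rule Sup_least) (auto simp: val_ge_def)

lemma order_along_principal:
  assumes "a \<in> Ov" "a \<noteq> 0"
  shows "order_along Ov (span_over Ov {a}) = enat (nat (v a))"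
  using assms by (intro antisym order_along_le order_along_ge) (auto simp: val_ge_def)

text \<open>This turns \<open>same_divisor\<close> into equality of \<open>v\<close> on nonzero
  functions. A function of negative value is handled as \<open>1 / inverse f\<close>.\<close>

lemma valuation_Ov:
  assumes "f \<noteq> 0"
  shows "valuation Ov f = v f"
  unfolding valuation_def
proof (rule the_equality)
  have val: "int (the_enat (order_along Ov (span_over Ov {a}))) = v a" if "a \<in> Ov - {0}" for a
  proof -
    have "0 \<le> v a" using that by (auto simp: val_ge_def)
    then show ?thesis using that by (simp add: order_along_principal)
  qed
  show "\<exists>a\<in>Ov - {0}. \<exists>b\<in>Ov - {0}. f = a / b \<and>
      v f = int (the_enat (order_along Ov (span_over Ov {a})))
          - int (the_enat (order_along Ov (span_over Ov {b})))"
  proof (cases "0 \<le> v f")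
    case True
    then have "f \<in> Ov - {0}" "1 \<in> Ov - {0}" using assms by (auto simp: val_ge_def)
    then show ?thesis using val by (intro bexI[of _ f] bexI[of _ 1]) auto
  next
    case False
    then have "inverse f \<in> Ov - {0}" "1 \<in> Ov - {0}" using assms by (auto simp: val_ge_def inverse)
    then show ?thesis using val assms
      by (intro bexI[of _ 1] bexI[of _ "inverse f"]) (auto simp: inverse divide_inverse)
  qed
  fix n assume "\<exists>a\<in>Ov - {0}. \<exists>b\<in>Ov - {0}. f = a / b \<and>
      n = int (the_enat (order_along Ov (span_over Ov {a})))
          - int (the_enat (order_along Ov (span_over Ov {b})))"
  then obtain a b where "a \<in> Ov - {0}" "b \<in> Ov - {0}" "f = a / b"
    "n = int (the_enat (order_along Ov (span_over Ov {a})))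
       - int (the_enat (order_along Ov (span_over Ov {b})))" by blast
  then show "n = v f" using val by (simp add: divide)
qed

end

section \<open>Lower bounds for log discrepancies\<close>

context discrete_valuation
begin

lemma jacobian_mem_canonical_stalk:
  assumes "f \<in> Ov" "g \<in> Ov"
  shows "jacobian f g \<in> canonical_stalk Ov"
  unfolding canonical_stalk_def by (rule subsetD[OF span_over_superset]) (use assms in blast)

text \<open>With \<open>f = a t\<^sup>m\<close> and \<open>g = b t\<^sup>n\<close>, the form \<open>df \<and> dg\<close> is \<open>t\<^sup>m\<^sup>+\<^sup>n\<^sup>-\<^sup>1\<close> times
  \<open>t da \<and> db + n b da \<and> dt + m a dt \<and> db\<close>: logarithmic forms have at most a simple pole.\<close>

lemma jacobian_log_pole:
  assumes t: "t \<noteq> 0" "v t = 1" and nz: "f \<noteq> 0" "g \<noteq> 0"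
  shows "\<exists>w\<in>canonical_stalk Ov. jacobian f g = t powi (v f + v g - 1) * w"
proof -
  define m n a b where "m = v f" and "n = v g" and "a = f / t powi m" and "b = g / t powi n"
  have fg: "f = a * t powi m" "g = b * t powi n" using t(1) by (simp_all add: a_def b_def)
  have ab: "a \<in> Ov" "b \<in> Ov" "t \<in> Ov"
    using t nz by (simp_all add: val_ge_def a_def b_def m_def n_def divide power_int)
  define w where "w = t * jacobian a b + of_int n * b * jacobian a t + of_int m * a * jacobian t b"
  \<comment> \<open>Differentiating powers of \<open>t\<close> produces integer factors; as
    constants they lie in the valuation ring.\<close>
  have "of_int i = (const (of_int i) :: 'k ratfun)" for i
    by (induction i rule: int_induct[of _ 0]) simp_all
  then have int: "of_int i \<in> Ov" for i using subalgebra_Ov by (auto simp: subalgebra_def)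
  have "t * jacobian a b \<in> canonical_stalk Ov"
    using jacobian_mem_canonical_stalk ab submodule_overD(3)[OF submodule_over_span]
    unfolding canonical_stalk_def by blast
  moreover have "(of_int n * b) * jacobian a t \<in> canonical_stalk Ov"
    using jacobian_mem_canonical_stalk ab is_subringD(4)[OF is_subring_Ov int[of n] ab(2)]
      submodule_overD(3)[OF submodule_over_span] unfolding canonical_stalk_def by blast
  moreover have "(of_int m * a) * jacobian t b \<in> canonical_stalk Ov"
    using jacobian_mem_canonical_stalk ab is_subringD(4)[OF is_subring_Ov int[of m] ab(1)]
      submodule_overD(3)[OF submodule_over_span] unfolding canonical_stalk_def by blast
  ultimately have "w \<in> canonical_stalk Ov"
    unfolding w_def canonical_stalk_def by (intro submodule_overD(2)[OF submodule_over_span])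
  moreover have "jacobian f g = t powi (m + n - 1) * w"
  proof -
    define T where "T = t powi (m + n - 1)"
    have T: "t powi m * t powi n = T * t" "t powi m * t powi (n - 1) = T" "t powi (m - 1) * t powi n = T"
      using t(1) power_int_add_1[of t "m + n - 1"] by (simp_all add: T_def algebra_simps flip: power_int_add)
    interpret Ja: derivation "jacobian x" for x by (rule derivation_jacobian)
    have Jn: "jacobian x (t powi n) = of_int n * t powi (n - 1) * jacobian x t" for x
      by (rule Ja.power_int[OF t(1)])
    have Jm: "jacobian (t powi m) x = of_int m * t powi (m - 1) * jacobian t x" for x
      using Ja.power_int[OF t(1), of x m] by (simp add: jacobian_swap[of _ x])
    have J2: "jacobian (x * y) z = x * jacobian y z + y * jacobian x z" for x y z :: "'k ratfun"
      using Ja.mult[of z x y] by (simp add: jacobian_swap[of _ z])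
    have "jacobian f g = (t powi m * t powi n) * jacobian a b
        + of_int n * b * (t powi m * t powi (n - 1)) * jacobian a t
        + of_int m * a * (t powi (m - 1) * t powi n) * jacobian t b"
      unfolding fg by (simp add: Ja.mult J2 Jn Jm algebra_simps)
    then show ?thesis unfolding T w_def T_def[symmetric] by (simp add: algebra_simps)
  qed
  ultimately show ?thesis unfolding m_def n_def by blast
qed

text \<open>The third hypothesis says \<open>h df \<and> dg = dx1 \<and> dx2\<close>, and
  \<open>jacobian_log_pole\<close> gives the vanishing of \<open>df \<and> dg\<close>. Each choice
  of \<open>f, g, h\<close> yields its own lower bound; the three identities below are the choices
  used.\<close>

lemma order_relative_canonical_ge:
  assumes "f \<noteq> 0" "g \<noteq> 0" "h * jacobian f g = 1" and n: "int n \<le> v f + v g + v h - 1"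
  shows "enat n \<le> order_relative_canonical Ov"
proof -
  obtain t where t: "t \<noteq> 0" "v t = 1" using uniformizer by blast
  have "h \<noteq> 0" using assms(3) by auto
  obtain w where w: "w \<in> canonical_stalk Ov" "jacobian f g = t powi (v f + v g - 1) * w"
    using jacobian_log_pole[OF t assms(1,2)] by blast
  have "h * t powi (v f + v g - 1) \<in> val_ge v (int n)"
    using n t \<open>h \<noteq> 0\<close> by (simp add: val_ge_def mult power_int)
  then have "h * t powi (v f + v g - 1) \<in> ideal_power Ov (max_ideal Ov) n"
    by (simp only: ideal_power_Ov)
  then have "h * t powi (v f + v g - 1) * w
      \<in> {x * y | x y. x \<in> ideal_power Ov (max_ideal Ov) n \<and> y \<in> canonical_stalk Ov}"
    using w(1) by blast
  moreover have "h * t powi (v f + v g - 1) * w = 1" using assms(3) w(2) by (simp add: mult.assoc)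
  ultimately have "1 \<in> module_prod Ov (ideal_power Ov (max_ideal Ov) n) (canonical_stalk Ov)"
    unfolding module_prod_def using span_over_superset by fastforce
  then show ?thesis unfolding order_relative_canonical_def by (intro Sup_upper) blast
qed

end

lemma jacobian_coords [simp]: "jacobian (to_fract X1) (to_fract X2) = 1"
  by (simp add: jacobian_def)

text \<open>The blow-up chart recentred at slope \<open>c\<close>. With \<open>f = x1/x2 - c\<close>
  and \<open>g = h = x2\<close> the resulting bound grows with the value of
  \<open>x1/x2 - c\<close>.\<close>

lemma jacobian_slope:
  "to_fract X2 * jacobian (to_fract X1 / to_fract X2 - const c) (to_fract X2) = (1 :: 'k::field ratfun)"
  by (simp add: jacobian_def d1.diff d2.diff d1.const d2.const d1.divide d2.divide)
    (simp add: power2_eq_square)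

text \<open>Both functions are chosen so that the cusp enters as one factor of a logarithmic form.
  The two products in the Jacobian have coefficients \<open>-2\<close> and \<open>3\<close>, which
  leave \<open>x^2 / y^5\<close>.\<close>

lemma jacobian_cusp:
  fixes x y :: "'k::field ratfun"
  defines "x \<equiv> to_fract X1" and "y \<equiv> to_fract X2"
  shows "y ^ 5 / x\<^sup>2 * jacobian ((x\<^sup>2 + y ^ 3) / y ^ 3) (x / y) = 1"
proof -
  have nz: "x \<noteq> 0" "y \<noteq> 0" by (simp_all add: x_def y_def)
  have d: "partial_x1 x = 1" "partial_x1 y = 0" "partial_x2 x = 0" "partial_x2 y = 1"
    by (simp_all add: x_def y_def)
  have 1: "partial_x1 ((x\<^sup>2 + y ^ 3) / y ^ 3) = 2 * x / y ^ 3"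
    using nz by (simp add: d1.divide d1.add d1.power d) (simp add: field_simps eval_nat_numeral)
  have 2: "partial_x2 ((x\<^sup>2 + y ^ 3) / y ^ 3) = - 3 * x\<^sup>2 / y ^ 4"
    using nz by (simp add: d2.divide d2.add d2.power d divide_simps) (simp add: algebra_simps eval_nat_numeral)
  have 3: "partial_x1 (x / y) = 1 / y" "partial_x2 (x / y) = - x / y\<^sup>2"
    using nz by (simp_all add: d1.divide d2.divide d power2_eq_square)
  show ?thesis unfolding jacobian_def 1 2 3 using nz
    by (simp add: divide_simps) (simp add: algebra_simps eval_nat_numeral)
qed

section \<open>Polynomials in two elements of the function field\<close>

lemma plane_induct [case_names const X1 X2 add mult]:
  fixes h :: "'k::field plane"
  assumes const: "\<And>c. P [:[:c:]:]" and X1: "P X1" and X2: "P X2"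
    and add: "\<And>f g. P f \<Longrightarrow> P g \<Longrightarrow> P (f + g)" and mult: "\<And>f g. P f \<Longrightarrow> P g \<Longrightarrow> P (f * g)"
  shows "P h"
proof (induction h)
  case 0
  then show ?case using const[of 0] by simp
next
  case (pCons r h)
  have "P [:r:]"
  proof (induction r)
    case 0
    then show ?case using const[of 0] by simp
  next
    case (pCons c r)
    have "P ([:[:c:]:] + X1 * [:r:])" using const X1 pCons add mult by blast
    then show ?case by (simp add: X1_def)
  qed
  then have "P ([:r:] + X2 * h)" using X2 pCons add mult by blast
  then show ?case by (simp add: X2_def)
qed

interpretation const_hom: comm_ring_hom "const :: 'k::field \<Rightarrow> 'k ratfun"
  by unfold_locales simp_all

text \<open>Substitution of \<open>u\<close> for \<open>X1\<close> and \<open>s\<close> for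
  \<open>X2\<close>; the inner evaluation treats the coefficients, which are polynomials in
  \<open>X1\<close>.\<close>

definition ev :: "'k::field ratfun \<Rightarrow> 'k ratfun \<Rightarrow> 'k plane \<Rightarrow> 'k ratfun" where
  "ev u s h = eval_poly (\<lambda>r. eval_poly const r u) h s"

lemma comm_ring_hom_eval_poly:
  "comm_ring_hom h \<Longrightarrow> comm_ring_hom (\<lambda>r. eval_poly h r x)"
proof -
  assume "comm_ring_hom h"
  then interpret comm_ring_hom h .
  interpret map_poly_hom: map_poly_comm_ring_hom h ..
  show "comm_ring_hom (\<lambda>r. eval_poly h r x)"
    unfolding eval_poly_def
    by unfold_locales (simp_all add: map_poly_hom.hom_add map_poly_hom.hom_mult)
qed

lemma ev_comm_ring_hom: "comm_ring_hom (ev u s)"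
  unfolding ev_def by (intro comm_ring_hom_eval_poly const_hom.comm_ring_hom_axioms)

interpretation ev: comm_ring_hom "ev u s"
  by (rule ev_comm_ring_hom)

lemma ev_generators [simp]:
  "ev u s X1 = u" "ev u s X2 = s" "ev u s [:[:c:]:] = const c"
  by (cases "c = 0"; simp add: ev_def eval_poly_def X1_def X2_def map_poly_pCons)+

lemma plane_partial_simps:
  "map_poly pderiv [:[:c:]:] = (0 :: 'k::field plane)" "pderiv [:[:c:]:] = (0 :: 'k plane)"
  "map_poly pderiv X1 = (1 :: 'k plane)" "pderiv X1 = (0 :: 'k plane)"
  "map_poly pderiv X2 = (0 :: 'k plane)" "pderiv X2 = (1 :: 'k plane)"
  "map_poly pderiv (f + g) = map_poly pderiv f + map_poly pderiv (g :: 'k plane)"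
proof -
  show "map_poly pderiv [:[:c:]:] = (0 :: 'k plane)"
    by (simp add: poly_eq_iff coeff_map_poly coeff_pCons pderiv_pCons split: nat.splits)
  show "map_poly pderiv (f + g) = map_poly pderiv f + map_poly pderiv (g :: 'k plane)"
    by (simp add: poly_eq_iff coeff_map_poly pderiv_add)
qed (simp_all add: X1_def X2_def map_poly_pCons pderiv_pCons)

lemma chain_rule:
  assumes "derivation D"
  shows "D (ev u s h) = ev u s (map_poly pderiv h) * D u + ev u s (pderiv h) * D s"
proof -
  interpret derivation D by fact
  show ?thesis
    by (induction h rule: plane_induct)
      (simp_all add: plane_partial_simps ev.hom_add ev.hom_mult add mult const map_poly_pderiv_mult
        pderiv_add pderiv_mult distrib_left distrib_right mult_ac add_ac)
qed

text \<open>A polynomial relation of minimal degree between \<open>u\<close> and \<open>s\<close> yields smaller ones by differentiation.\<close>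

lemma ev_injective:
  fixes u s :: "'k::field_char_0 ratfun"
  assumes J: "jacobian u s \<noteq> 0" and "ev u s h = 0"
  shows "h = 0"
proof -
  have zero: "ev u s (map_poly pderiv h) = 0 \<and> ev u s (pderiv h) = 0" if "ev u s h = 0" for h
  proof -
    have D: "ev u s (map_poly pderiv h) * D u + ev u s (pderiv h) * D s = 0" if "derivation D" for D
      using chain_rule[OF that, of u s h] \<open>ev u s h = 0\<close> derivation.zero[OF that] by simp
    note D1 = D[OF d1.derivation_axioms] and D2 = D[OF d2.derivation_axioms]
    let ?a = "ev u s (map_poly pderiv h)" and ?b = "ev u s (pderiv h)"
    \<comment> \<open>Cramer's rule for the two linear equations in \<open>?a\<close> and
      \<open>?b\<close>, whose determinant is \<open>jacobian u s\<close>.\<close>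
    have "?a * jacobian u s = (?a * partial_x1 u + ?b * partial_x1 s) * partial_x2 s
          - (?a * partial_x2 u + ?b * partial_x2 s) * partial_x1 s"
      "?b * jacobian u s = (?a * partial_x2 u + ?b * partial_x2 s) * partial_x1 u
          - (?a * partial_x1 u + ?b * partial_x1 s) * partial_x2 u"
      unfolding jacobian_def by (simp_all add: algebra_simps)
    then have "?a * jacobian u s = 0" "?b * jacobian u s = 0" unfolding D1 D2 by simp_all
    then show ?thesis using J by simp
  qed
  \<comment> \<open>Relations free of \<open>X2\<close> form the base case of the induction on the
    degree in \<open>X2\<close>. In characteristic zero a vanishing derivative forces degree
    zero.\<close>
  have inner: "r = 0" if "ev u s [:r:] = 0" for r
    using that
  proof (induction "degree r" arbitrary: r rule: less_induct)
    case less
    show ?case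
    proof (cases "degree r = 0")
      case True
      then obtain c where "r = [:c:]" by (rule degree_eq_zeroE)
      then show ?thesis using less.prems by simp
    next
      case False
      have "map_poly pderiv [:r:] = [:pderiv r:]" by (cases "r = 0") (simp_all add: map_poly_pCons)
      then have "ev u s [:pderiv r:] = 0" using zero[OF less.prems] by simp
      then have "pderiv r = 0" using less.hyps False by (simp add: degree_pderiv)
      then show ?thesis using False by (simp add: pderiv_eq_0_iff)
    qed
  qed
  show ?thesis
    using assms(2)
  proof (induction "degree h" arbitrary: h rule: less_induct)
    case less
    show ?case
    proof (cases "degree h = 0")
      case True
      then obtain r where "h = [:r:]" by (rule degree_eq_zeroE)
      then show ?thesis using less.prems inner by simp
    next
      case False
      then have "pderiv h = 0" using less.hyps zero[OF less.prems] by (simp add: degree_pderiv)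
      then show ?thesis using False by (simp add: pderiv_eq_0_iff)
    qed
  qed
qed

section \<open>Unique factorization\<close>

lemma irreducible_dvd_mult_ufd:
  fixes r :: "'a::ufd"
  assumes "irreducible r" "r dvd a * b"
  shows "r dvd a \<or> r dvd b"
proof (rule prime_elem_dvd_multD)
  show "prime_elem r" using assms(1) prime_elem_iff_irreducible by (rule iffD2[rotated])
qed (rule assms(2))

lemma irreducible_dvd_power_ufd:
  fixes r :: "'a::ufd"
  assumes "irreducible r" "r dvd a ^ n"
  shows "r dvd a"
  using assms(2)
proof (induction n)
  case 0
  then show ?case using irreducible_not_unit[OF assms(1)] by simp
next
  case (Suc n)
  then show ?case using irreducible_dvd_mult_ufd[OF assms(1)] by auto
qed

text \<open>The coprimality step of the rational root theorem: each irreducible factor that avoids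
  \<open>a\<close> must divide \<open>t\<close>, and can be cancelled before the next one is
  treated.\<close>

lemma prod_irreducibles_dvd_cancel:
  fixes a t :: "'a::ufd"
  assumes "\<And>r. r \<in># F \<Longrightarrow> irreducible r \<and> \<not> r dvd a" "prod_mset F dvd t * a ^ n"
  shows "prod_mset F dvd t"
  using assms
proof (induction F arbitrary: t)
  case (add r F)
  have r: "irreducible r" "\<not> r dvd a" using add.prems(1) by auto
  have "r dvd t * a ^ n" using add.prems(2) dvd_mult_left by auto
  then have "r dvd t" using irreducible_dvd_mult_ufd[OF r(1)] irreducible_dvd_power_ufd[OF r(1)] r(2) by blast
  then obtain t' where t: "t = r * t'" by (elim dvdE)
  have "r \<noteq> 0" using r(1) by auto
  then have "prod_mset F dvd t' * a ^ n" using add.prems(2) by (simp add: t mult.assoc)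
  moreover have "\<And>r. r \<in># F \<Longrightarrow> irreducible r \<and> \<not> r dvd a" using add.prems(1) by simp
  ultimately have "prod_mset F dvd t'" by (rule add.IH[rotated])
  then show ?case by (simp add: t mult_dvd_mono)
qed simp

lemma factorization_ufd:
  fixes b :: "'a::ufd"
  assumes "b \<noteq> 0"
  obtains w F where "w dvd 1" "b = w * prod_mset F" "\<forall>r\<in>#F. irreducible r"
proof (cases "b dvd 1")
  case True
  then show thesis using that[of b "{#}"] by simp
next
  case False
  then obtain F where "mset_factors F b" using mset_factors_exist assms by blast
  then show thesis using that[of 1 F] mset_factorsD[of F b] by auto
qed

text \<open>Common irreducible factors are removed one by one, by induction on their number in the
  denominator. The result is cross-multiplied, with denominator \<open>w * prod_mset F\<close> for a
  unit \<open>w\<close>.\<close>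

lemma fraction_in_lowest_terms:
  fixes a b :: "'a::ufd"
  assumes "b \<noteq> 0"
  obtains a' w F where "w dvd 1" "a * (w * prod_mset F) = a' * b"
    "\<forall>r\<in>#F. irreducible r \<and> \<not> r dvd a'"
proof -
  have *: "\<exists>a' w' F'. w' dvd 1 \<and> a * (w' * prod_mset F') = a' * (w * prod_mset F)
      \<and> (\<forall>r\<in>#F'. irreducible r \<and> \<not> r dvd a')"
    if "w dvd 1" "\<forall>r\<in>#F. irreducible r" for w :: 'a and F
    using that
  proof (induction "size F" arbitrary: a F)
    case 0
    then show ?case by (intro exI[of _ a] exI[of _ w] exI[of _ "{#}"]) auto
  next
    case (Suc n)
    show ?case
    proof (cases "\<exists>r\<in>#F. r dvd a")
      case True
      then obtain r where r: "r \<in># F" "r dvd a" by blast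
      then obtain F1 where F: "F = add_mset r F1" by (metis mset_add)
      obtain a1 where a: "a = r * a1" using r(2) by (elim dvdE)
      have "n = size F1" "\<forall>r\<in>#F1. irreducible r" using Suc.hyps(2) Suc.prems(2) F by auto
      from Suc.hyps(1)[OF this(1) Suc.prems(1) this(2), of a1] obtain a' w' F'
        where **: "w' dvd 1" "a1 * (w' * prod_mset F') = a' * (w * prod_mset F1)"
          "\<forall>r\<in>#F'. irreducible r \<and> \<not> r dvd a'" by blast
      have "a * (w' * prod_mset F') = r * (a1 * (w' * prod_mset F'))" by (simp add: a mult_ac)
      also have "\<dots> = a' * (w * prod_mset F)" unfolding **(2) by (simp add: F mult_ac)
      finally show ?thesis using **(1,3) by blast
    next
      case False
      then show ?thesis using Suc.prems by (intro exI[of _ a] exI[of _ w] exI[of _ F]) auto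
    qed
  qed
  obtain w F where wF: "w dvd 1" "b = w * prod_mset F" "\<forall>r\<in>#F. irreducible r"
    using factorization_ufd[OF assms] by blast
  obtain a' w' F' where "w' dvd 1" "a * (w' * prod_mset F') = a' * (w * prod_mset F)"
      "\<forall>r\<in>#F'. irreducible r \<and> \<not> r dvd a'"
    using *[OF wF(1,3)] by blast
  then show thesis using that wF(2) by simp
qed

section \<open>Monomial charts\<close>

lemma origin_eq: "origin = {f :: 'k::field plane. coeff (coeff f 0) 0 = 0}"
proof
  have "submodule_over UNIV {f :: 'k plane. coeff (coeff f 0) 0 = 0}"
    by (auto simp: submodule_over_def coeff_mult)
  then show "origin \<subseteq> {f :: 'k plane. coeff (coeff f 0) 0 = 0}"
    unfolding origin_def by (intro span_over_minimal) (auto simp: X1_def X2_def)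
  have gens: "X1 \<in> (origin :: 'k plane set)" "X2 \<in> (origin :: 'k plane set)"
    unfolding origin_def using span_over_superset[of "{X1, X2 :: 'k plane}" UNIV] by auto
  have "submodule_over UNIV (origin :: 'k plane set)" unfolding origin_def by (rule submodule_over_span)
  note sub = submodule_overD[OF this]
  show "{f :: 'k plane. coeff (coeff f 0) 0 = 0} \<subseteq> origin"
  proof
    fix f :: "'k plane" assume "f \<in> {f. coeff (coeff f 0) 0 = 0}"
    then have f: "coeff (coeff f 0) 0 = 0" by simp
    obtain r g where fr: "f = pCons r g" by (cases f)
    obtain d q where "r = pCons d q" by (cases r)
    then have r: "r = pCons 0 q" using f fr by simp
    have "f = [:q:] * X1 + g * X2" by (simp add: fr r X1_def X2_def)
    moreover have "[:q:] * X1 + g * X2 \<in> origin"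
      by (rule sub(2)[OF sub(3)[OF UNIV_I gens(1)] sub(3)[OF UNIV_I gens(2)]])
    ultimately show "f \<in> origin" by (simp only:)
  qed
qed

text \<open>A centre consists of all primes above a contraction, so a centre equal to
  \<open>{origin}\<close> requires maximality. A member of \<open>Q\<close> with constant term
  \<open>c\<close> other than 0 puts the unit \<open>c\<close> into \<open>Q\<close>.\<close>

lemma origin_maximal:
  assumes "prime_ideal_of UNIV Q" "(origin :: 'k::field plane set) \<subseteq> Q"
  shows "Q = origin"
proof (rule ccontr)
  assume "Q \<noteq> origin"
  then obtain f where f: "f \<in> Q" "f \<notin> origin" using assms(2) by blast
  note Q = submodule_overD[OF prime_ideal_ofD(1)[OF assms(1)]]
  define c where "c = coeff (coeff f 0) 0"
  have "c \<noteq> 0" using f(2) by (simp add: origin_eq c_def)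
  have "f - [:[:c:]:] \<in> Q" using assms(2) by (auto simp: origin_eq c_def)
  then have "f + (-1) * (f - [:[:c:]:]) \<in> Q" using Q(2,3) f(1) by blast
  then have "[:[:inverse c:]:] * (f + (-1) * (f - [:[:c:]:])) \<in> Q" using Q(3) by blast
  moreover have "f + (-1) * (f - [:[:c:]:]) = [:[:c:]:]" by simp
  moreover have "[:[:inverse c:]:] * [:[:c:]:] = 1" using \<open>c \<noteq> 0\<close> by simp
  ultimately have "1 \<in> Q" by (simp only:)
  then show False using prime_ideal_ofD(3)[OF assms(1)] by blast
qed

lemma prime_origin: "prime_ideal_of UNIV (origin :: 'k::field plane set)"
proof -
  have "submodule_over UNIV (origin :: 'k plane set)" unfolding origin_def by (rule submodule_over_span)
  then show ?thesis by (auto simp: prime_ideal_of_def origin_eq coeff_mult)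
qed

text \<open>The outer variable is \<open>X2\<close>, so \<open>Polynomial.order 0\<close> counts
  factors \<open>X2\<close>. In a chart this is the order of vanishing along
  \<open>s = 0\<close>.\<close>

lemma order_0_eq_0_iff: "h \<noteq> 0 \<Longrightarrow> Polynomial.order 0 h = 0 \<longleftrightarrow> coeff h 0 \<noteq> 0"
  by (simp add: order_eq_0_iff poly_0_coeff_0)

lemma X2_power_eq_monom: "X2 ^ n = monom 1 n"
  by (simp add: X2_def monom_altdef)

lemma order_0_coords:
  "Polynomial.order 0 (X1 :: 'k::field plane) = 0" "Polynomial.order 0 (X2 :: 'k plane) = 1"
proof -
  show "Polynomial.order 0 (X1 :: 'k plane) = 0" by (subst order_0_eq_0_iff) (simp_all add: X1_def)
  have "X2 = (monom 1 1 :: 'k plane)" using X2_power_eq_monom[of 1, where ?'a = 'k] by simp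
  then show "Polynomial.order 0 (X2 :: 'k plane) = 1" using order_0_monom[of "1 :: 'k poly" 1] by simp
qed

lemma order_0_decomp:
  fixes h :: "'k::field plane"
  assumes "n \<le> Polynomial.order 0 h" "h \<noteq> 0"
  obtains g where "h = X2 ^ n * g" "Polynomial.order 0 h = n + Polynomial.order 0 g" "g \<noteq> 0"
proof -
  have "monom 1 n dvd h" using assms by (simp add: monom_1_dvd_iff)
  then obtain g where g: "h = monom 1 n * g" by (elim dvdE)
  then have "Polynomial.order 0 h = n + Polynomial.order 0 g" using assms(2) order_mult[of "monom 1 n" g 0] by simp
  then show thesis using that g assms(2) by (auto simp: X2_power_eq_monom)
qed

lemma common_denominator:
  assumes A: "is_subring A" and Q: "prime_ideal_of A Q" and P: "\<forall>i. coeff P i \<in> localization A Q"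
  shows "\<exists>\<sigma>\<in>A - Q. \<forall>i\<le>n. \<sigma> * coeff P i \<in> A"
proof (induction n)
  case (Suc n)
  then obtain \<sigma> where \<sigma>: "\<sigma> \<in> A - Q" "\<forall>i\<le>n. \<sigma> * coeff P i \<in> A" by blast
  have "coeff P (Suc n) \<in> localization A Q" using P by blast
  then obtain a \<tau> where a: "coeff P (Suc n) = a / \<tau>" "a \<in> A" "\<tau> \<in> A - Q"
    unfolding localization_def by blast
  then have "\<tau> \<noteq> 0" using prime_ideal_ofD(4)[OF Q] by auto
  have "\<sigma> * \<tau> * coeff P i \<in> A" if "i \<le> Suc n" for i
  proof (cases "i = Suc n")
    case True
    then have "\<tau> * coeff P i = a" using a(1) \<open>\<tau> \<noteq> 0\<close> by simp
    then have "\<sigma> * \<tau> * coeff P i = \<sigma> * a" by (simp only: mult.assoc)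
    then show ?thesis using is_subringD(4)[OF A _ a(2), of \<sigma>] \<sigma>(1) by (simp only: Diff_iff)
  next
    case False
    then have "\<tau> * (\<sigma> * coeff P i) \<in> A" using is_subringD(4)[OF A] \<sigma>(2) a(3) that by simp
    then show ?thesis by (simp add: mult_ac)
  qed
  then show ?case using prime_complement_mult[OF A Q \<sigma>(1) a(3)] by blast
next
  case 0
  have "coeff P 0 \<in> localization A Q" using P by blast
  then obtain a \<tau> where a: "coeff P 0 = a / \<tau>" "a \<in> A" "\<tau> \<in> A - Q"
    unfolding localization_def by blast
  then have "\<tau> \<noteq> 0" using prime_ideal_ofD(4)[OF Q] by auto
  then have "\<tau> * coeff P 0 = a" using a(1) by simp
  then have "\<forall>i\<le>0. \<tau> * coeff P i \<in> A" using a(2) by simp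
  then show ?case using a(3) by (rule bexI)
qed

text \<open>The divisor is the line \<open>s = 0\<close> of a chart \<open>Spec k[u, s]\<close>; the prescribed Jacobian amounts to
  \<open>a q - c p = 1\<close> for \<open>u = x1\<^sup>q x2\<^sup>-\<^sup>p\<close> and \<open>s = x1\<^sup>-\<^sup>c x2\<^sup>a\<close>.\<close>

locale monomial_chart =
  fixes u s :: "'k::field_char_0 ratfun" and a c p q :: nat
  assumes x1: "to_fract X1 = u ^ a * s ^ p" and x2: "to_fract X2 = u ^ c * s ^ q"
    and u: "u \<noteq> 0" and s: "s \<noteq> 0" and p: "0 < p" and q: "0 < q"
    and jac: "jacobian u s = u * s / (to_fract X1 * to_fract X2)"
begin

lemma jacobian_nonzero: "jacobian u s \<noteq> 0"
  using u s by (simp add: jac)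

lemma ev_eq_0_iff [simp]: "ev u s h = 0 \<longleftrightarrow> h = 0"
  using ev_injective[OF jacobian_nonzero] by auto

lemma ev_eq_iff [simp]: "ev u s g = ev u s h \<longleftrightarrow> g = h"
  using ev_eq_0_iff[of "g - h"] by (simp only: ev.hom_minus right_minus_eq)

lemma to_fract_mem_range: "to_fract f \<in> range (ev u s)"
proof (induction f rule: plane_induct)
  case (const c)
  show ?case by (rule range_eqI[of _ _ "[:[:c:]:]"]) (simp add: const_def)
next
  case X1
  show ?case by (rule range_eqI[of _ _ "X1 ^ a * X2 ^ p"]) (simp add: x1 ev.hom_mult ev.hom_power)
next
  case X2
  show ?case by (rule range_eqI[of _ _ "X1 ^ c * X2 ^ q"]) (simp add: x2 ev.hom_mult ev.hom_power)
next
  case (add f g)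
  then obtain h k where "to_fract f = ev u s h" "to_fract g = ev u s k" by blast
  then show ?case by (intro range_eqI[of _ _ "h + k"]) (simp add: ev.hom_add)
next
  case (mult f g)
  then obtain h k where "to_fract f = ev u s h" "to_fract g = ev u s k" by blast
  then show ?case by (intro range_eqI[of _ _ "h * k"]) (simp add: ev.hom_mult)
qed

lemma ev_fraction_cases:
  obtains g h where "h \<noteq> 0" "f = ev u s g / ev u s h"
proof -
  obtain a b where ab: "b \<noteq> 0" "f = to_fract a / to_fract b" by (rule fraction_cases)
  obtain g h where gh: "to_fract a = ev u s g" "to_fract b = ev u s h"
    using to_fract_mem_range[of a] to_fract_mem_range[of b] by blast
  then have "h \<noteq> 0" using ab(1) by auto
  then show thesis using that ab(2) gh by simp
qed

definition v :: "'k ratfun \<Rightarrow> int" where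
  "v f = (THE n. \<exists>g h. g \<noteq> 0 \<and> h \<noteq> 0 \<and> f = ev u s g / ev u s h \<and> n = int (Polynomial.order 0 g) - int (Polynomial.order 0 h))"

lemma v_fraction:
  assumes "g \<noteq> 0" "h \<noteq> 0"
  shows "v (ev u s g / ev u s h) = int (Polynomial.order 0 g) - int (Polynomial.order 0 h)"
  unfolding v_def
proof (rule the_equality)
  fix n assume "\<exists>g' h'. g' \<noteq> 0 \<and> h' \<noteq> 0 \<and> ev u s g / ev u s h = ev u s g' / ev u s h'
      \<and> n = int (Polynomial.order 0 g') - int (Polynomial.order 0 h')"
  then obtain g' h' where *: "g' \<noteq> 0" "h' \<noteq> 0" "ev u s g / ev u s h = ev u s g' / ev u s h'"
    "n = int (Polynomial.order 0 g') - int (Polynomial.order 0 h')" by blast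
  then have "ev u s (g * h') = ev u s (g' * h)"
    using assms by (simp add: ev.hom_mult frac_eq_eq)
  then have "Polynomial.order 0 (g * h') = Polynomial.order 0 (g' * h)" by simp
  then show "n = int (Polynomial.order 0 g) - int (Polynomial.order 0 h)" using * assms by (simp add: order_mult)
qed (use assms in blast)

lemma v_ev: "g \<noteq> 0 \<Longrightarrow> v (ev u s g) = int (Polynomial.order 0 g)"
  using v_fraction[of g 1] by simp

sublocale discrete_valuation v
proof
  fix f g :: "'k ratfun" assume nz: "f \<noteq> 0" "g \<noteq> 0"
  obtain a b where f: "b \<noteq> 0" "f = ev u s a / ev u s b" by (rule ev_fraction_cases)
  obtain c d where g: "d \<noteq> 0" "g = ev u s c / ev u s d" by (rule ev_fraction_cases)
  have ac: "a \<noteq> 0" "c \<noteq> 0" using nz f g by auto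
  have "f * g = ev u s (a * c) / ev u s (b * d)" by (simp add: f(2) g(2) ev.hom_mult)
  then have "v (f * g) = int (Polynomial.order 0 (a * c)) - int (Polynomial.order 0 (b * d))"
    using v_fraction[of "a * c" "b * d"] ac f(1) g(1) by simp
  then show "v (f * g) = v f + v g"
    using ac f(1) g(1) by (simp add: f(2) g(2) v_fraction order_mult)
  assume "f + g \<noteq> 0"
  have sum: "f + g = ev u s (a * d + c * b) / ev u s (b * d)"
    using f(1) g(1) by (simp add: f(2) g(2) ev.hom_mult ev.hom_add add_frac_eq)
  then have nz': "a * d + c * b \<noteq> 0" using \<open>f + g \<noteq> 0\<close> by auto
  define m where "m = min (Polynomial.order 0 (a * d)) (Polynomial.order 0 (c * b))"
  have "monom 1 m dvd a * d" "monom 1 m dvd c * b"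
    using ac f(1) g(1) by (simp_all add: monom_1_dvd_iff m_def)
  then have "monom 1 m dvd a * d + c * b" by (rule dvd_add)
  then have "m \<le> Polynomial.order 0 (a * d + c * b)" using nz' by (simp add: monom_1_dvd_iff)
  then show "min (v f) (v g) \<le> v (f + g)"
    unfolding sum v_fraction[OF nz' no_zero_divisors[OF f(1) g(1)]]
    using ac f(1) g(1) by (simp add: f(2) g(2) v_fraction order_mult m_def min_def split: if_splits)
next
  have "v s = 1" using v_ev[of X2] by (simp add: order_0_coords)
  then show "\<exists>t. t \<noteq> 0 \<and> v t = 1" using s by blast
next
  fix c :: 'k assume "c \<noteq> 0"
  then show "v (const c) = 0" using v_ev[of "[:[:c:]:]"] order_0_eq_0_iff[of "[:[:c:]:]"] by simp
qed

lemma v_coords: "v u = 0" "v s = 1" "v (to_fract X1) = int p" "v (to_fract X2) = int q"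
proof -
  show vu: "v u = 0" using v_ev[of X1] by (simp add: order_0_coords)
  show vs: "v s = 1" using v_ev[of X2] by (simp add: order_0_coords)
  show "v (to_fract X1) = int p" "v (to_fract X2) = int q"
    unfolding x1 x2 using u s by (simp_all add: mult power vu vs)
qed

text \<open>Cancelling the power of \<open>X2\<close> in the denominator identifies the valuation
  ring with the localization of \<open>k[u, s]\<close> at the prime generated by
  \<open>s\<close>.\<close>

lemma Ov_iff: "f \<in> Ov \<longleftrightarrow> (\<exists>g h. coeff h 0 \<noteq> 0 \<and> f = ev u s g / ev u s h)"
proof
  assume f: "f \<in> Ov"
  show "\<exists>g h. coeff h 0 \<noteq> 0 \<and> f = ev u s g / ev u s h"
  proof (cases "f = 0")
    case True
    then show ?thesis by (intro exI[of _ 0] exI[of _ 1]) simp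
  next
    case False
    obtain g h where gh: "h \<noteq> 0" "f = ev u s g / ev u s h" by (rule ev_fraction_cases)
    then have g: "g \<noteq> 0" using False by auto
    have le: "Polynomial.order 0 h \<le> Polynomial.order 0 g"
      using f False v_fraction[OF g gh(1)] by (simp add: val_ge_def gh(2))
    obtain g' where g': "g = X2 ^ Polynomial.order 0 h * g'" using order_0_decomp[OF le g] .
    obtain h' where h': "h = X2 ^ Polynomial.order 0 h * h'" "Polynomial.order 0 h = Polynomial.order 0 h + Polynomial.order 0 h'" "h' \<noteq> 0"
      using order_0_decomp[OF le_refl gh(1)] .
    have "ev u s g = s ^ Polynomial.order 0 h * ev u s g'"
      using arg_cong[OF g', of "ev u s"] by (simp only: ev.hom_mult ev.hom_power ev_generators)
    moreover have "ev u s h = s ^ Polynomial.order 0 h * ev u s h'"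
      using arg_cong[OF h'(1), of "ev u s"] by (simp only: ev.hom_mult ev.hom_power ev_generators)
    ultimately have "f = ev u s g' / ev u s h'" using s by (simp add: gh(2))
    moreover have "coeff h' 0 \<noteq> 0" using h'(2) order_0_eq_0_iff[OF h'(3)] by simp
    ultimately show ?thesis by blast
  qed
next
  assume "\<exists>g h. coeff h 0 \<noteq> 0 \<and> f = ev u s g / ev u s h"
  then obtain g h where gh: "coeff h 0 \<noteq> 0" "f = ev u s g / ev u s h" by blast
  then have "h \<noteq> 0" by auto
  then show "f \<in> Ov"
    using gh v_fraction[of g h] order_0_eq_0_iff[of h] by (cases "g = 0") (auto simp: val_ge_def)
qed

definition A :: "'k ratfun set" where "A = range (ev u s)"

lemma subalgebra_A: "subalgebra A"
proof -
  have "const c \<in> A" for c unfolding A_def by (rule range_eqI[of _ _ "[:[:c:]:]"]) simp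
  then show ?thesis
    unfolding subalgebra_def A_def by (auto simp flip: ev.hom_add ev.hom_mult)
qed

lemma is_subring_A: "is_subring A"
  by (rule is_subring_subalgebra[OF subalgebra_A])

lemma A_eq_hull: "A = subalgebra hull {u, s}"
proof (rule hull_unique[symmetric])
  show "{u, s} \<subseteq> A" unfolding A_def using ev_generators(1,2)[of u s, symmetric] by blast
  show "subalgebra A" by (rule subalgebra_A)
  fix B assume B: "{u, s} \<subseteq> B" "subalgebra B"
  have "ev u s h \<in> B" for h
    using B by (induction h rule: plane_induct) (auto simp: subalgebra_def ev.hom_add ev.hom_mult)
  then show "A \<subseteq> B" by (auto simp: A_def)
qed

text \<open>The rational root argument in the factorial ring \<open>k[u, s]\<close>: the reduced
  denominator \<open>h\<close> of \<open>z\<close> divides the leading coefficient once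
  \<open>\<sigma>\<close> has cleared the denominators of \<open>P\<close>. As \<open>P\<close> is
  monic, that coefficient is \<open>\<sigma>\<close> itself, which is invertible in the
  localization.\<close>

lemma integrally_closed_localization:
  assumes Q: "prime_ideal_of A Q"
  shows "integrally_closed (localization A Q)"
  unfolding integrally_closed_def
proof (intro allI impI)
  fix z assume "\<exists>P. lead_coeff P = 1 \<and> (\<forall>i. coeff P i \<in> localization A Q) \<and> poly P z = 0"
  then obtain P where P: "lead_coeff P = 1" "\<forall>i. coeff P i \<in> localization A Q" "poly P z = 0" by blast
  define n where "n = degree P"
  obtain \<sigma> where \<sigma>: "\<sigma> \<in> A - Q" "\<forall>i\<le>n. \<sigma> * coeff P i \<in> A"
    using common_denominator[OF is_subring_A Q P(2)] by blast
  obtain g0 h0 where gh0: "h0 \<noteq> 0" "z = ev u s g0 / ev u s h0" by (rule ev_fraction_cases)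
  obtain g w F where F: "w dvd 1" "g0 * (w * prod_mset F) = g * h0"
    "\<forall>r\<in>#F. irreducible r \<and> \<not> r dvd g"
    by (rule fraction_in_lowest_terms[OF gh0(1), of g0])
  define h where "h = w * prod_mset F"
  have "w \<noteq> 0" using F(1) by auto
  moreover have "0 \<notin># F" using F(3) by auto
  ultimately have "h \<noteq> 0" by (simp add: h_def)
  have "ev u s g0 * ev u s h = ev u s g * ev u s h0"
    using F(2) by (simp flip: ev.hom_mult add: h_def)
  then have z: "z = ev u s g / ev u s h" using gh0 \<open>h \<noteq> 0\<close> by (simp add: frac_eq_eq)
  have "\<forall>i. \<exists>b. i \<le> n \<longrightarrow> \<sigma> * coeff P i = ev u s b" using \<sigma>(2) by (auto simp: A_def)
  from choice[OF this] obtain b where b: "\<And>i. i \<le> n \<Longrightarrow> \<sigma> * coeff P i = ev u s (b i)" by blast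
  \<comment> \<open>The equation for \<open>z = g / h\<close> is multiplied by
    \<open>\<sigma>\<close> and by the \<open>n\<close>-th power of the denominator. Every term
    except the one with \<open>i = n\<close> then contains \<open>h\<close>.\<close>
  have "ev u s (\<Sum>i\<le>n. b i * g ^ i * h ^ (n - i)) = (\<Sum>i\<le>n. ev u s (b i) * ev u s g ^ i * ev u s h ^ (n - i))"
    by (simp add: ev.hom_sum ev.hom_mult ev.hom_power)
  also have "\<dots> = (\<Sum>i\<le>n. \<sigma> * ev u s h ^ n * (coeff P i * z ^ i))"
  proof (rule sum.cong)
    fix i assume "i \<in> {..n}"
    then have i: "i \<le> n" by simp
    then have "ev u s h ^ n = ev u s h ^ i * ev u s h ^ (n - i)" by (simp flip: power_add)
    then have "ev u s h ^ n * z ^ i = ev u s g ^ i * ev u s h ^ (n - i)"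
      using \<open>h \<noteq> 0\<close> by (simp add: z power_divide)
    moreover have "\<sigma> * ev u s h ^ n * (coeff P i * z ^ i) = (\<sigma> * coeff P i) * (ev u s h ^ n * z ^ i)"
      by (simp only: mult_ac)
    ultimately show "ev u s (b i) * ev u s g ^ i * ev u s h ^ (n - i)
        = \<sigma> * ev u s h ^ n * (coeff P i * z ^ i)"
      by (simp only: b[OF i] mult.assoc)
  qed simp
  also have "\<dots> = \<sigma> * ev u s h ^ n * poly P z" by (simp add: poly_altdef sum_distrib_left n_def)
  finally have "(\<Sum>i\<le>n. b i * g ^ i * h ^ (n - i)) = 0" using P(3) by simp
  moreover have "(\<Sum>i\<le>n. b i * g ^ i * h ^ (n - i)) = (\<Sum>i<n. b i * g ^ i * h ^ (n - i)) + b n * g ^ n"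
    by (simp flip: lessThan_Suc_atMost)
  moreover have "h dvd (\<Sum>i<n. b i * g ^ i * h ^ (n - i))"
    by (intro dvd_sum dvd_mult) (simp add: dvd_power)
  ultimately have "h dvd b n * g ^ n" using dvd_add_right_iff[of h] by fastforce
  then have "prod_mset F dvd b n * g ^ n" unfolding h_def by (rule dvd_mult_right)
  then have "prod_mset F dvd b n" using prod_irreducibles_dvd_cancel F(3) by blast
  \<comment> \<open>The factor \<open>w\<close> of \<open>h\<close> is a unit.\<close>
  moreover have "h dvd prod_mset F" using F(1) mult_dvd_mono[of w 1 "prod_mset F"] by (simp add: h_def)
  ultimately have "h dvd b n" using dvd_trans by blast
  then obtain e where e: "b n = h * e" by (elim dvdE)
  have "\<sigma> = ev u s (b n)" using b[of n] P(1) by (simp add: n_def)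
  also have "\<dots> = ev u s h * ev u s e" unfolding e by (rule ev.hom_mult)
  finally have "\<sigma> = ev u s h * ev u s e" .
  moreover have "\<sigma> \<noteq> 0" using \<sigma>(1) prime_ideal_ofD(4)[OF Q] by auto
  ultimately have "z = ev u s (g * e) / \<sigma>" by (simp add: z ev.hom_mult)
  then show "z \<in> localization A Q" unfolding localization_def A_def[symmetric] using \<sigma>(1)
    by (auto simp: A_def)
qed

text \<open>The single affine chart \<open>Spec k[u, s]\<close> serves as the variety, and the prime
  generated by \<open>s\<close> gives the generic point of the divisor.\<close>

lemma Ov_mem_divisors: "Ov \<in> divisors_over_plane"
proof -
  let ?Y = "local_rings A"
  have to_fract_A: "range to_fract \<subseteq> A" unfolding A_def using to_fract_mem_range by blast
  have fg: "finitely_generated_algebra A"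
    unfolding finitely_generated_algebra_def A_eq_hull by (rule exI[of _ "{u, s}"]) simp
  have separated: "R = S"
    if "R \<in> ?Y" "S \<in> ?Y" "dominates V R" "dominates V S" for V R S
  proof -
    \<comment> \<open>The valuation ring recovers the prime: its maximal ideal meets
      \<open>A\<close> exactly in \<open>Q\<close>. Two local rings of this chart dominated by one
      \<open>V\<close> therefore coincide.\<close>
    have Q_eq: "Q = max_ideal V \<inter> A" if Q: "prime_ideal_of A Q" and dom: "dominates V (localization A Q)" for Q
    proof -
      note loc = localization_props[OF is_subring_A Q]
      have "x \<in> Q \<longleftrightarrow> x \<in> max_ideal (localization A Q)" if "x \<in> A" for x
      proof
        assume "x \<in> Q"
        have False if inv: "inverse x \<in> localization A Q" and "x \<noteq> 0"
        proof -
          obtain b t where bt: "inverse x = b / t" "b \<in> A" "t \<in> A - Q"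
            using inv unfolding localization_def by blast
          then have "t \<noteq> 0" using prime_ideal_ofD(4)[OF Q] by auto
          then have "t = b * x" using bt(1) \<open>x \<noteq> 0\<close> by (simp add: field_simps)
          then have "t \<in> Q" using submodule_overD(3)[OF prime_ideal_ofD(1)[OF Q] bt(2) \<open>x \<in> Q\<close>] by simp
          then show False using bt(3) by blast
        qed
        then show "x \<in> max_ideal (localization A Q)"
          using loc(1) that unfolding max_ideal_def by auto
      next
        assume "x \<in> max_ideal (localization A Q)"
        then show "x \<in> Q" using loc(3)[of x] prime_ideal_ofD(4)[OF Q] that by (auto simp: max_ideal_def)
      qed
      then show ?thesis
        using dom loc(1) prime_ideal_ofD(2)[OF Q] unfolding dominates_def by blast
    qed
    then show ?thesis using that unfolding local_rings_def by blast
  qed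
  have "birational_over_plane ?Y"
    unfolding birational_over_plane_def
  proof (intro conjI exI[of _ "{A}"] allI impI ballI)
  qed (use fg to_fract_A separated in auto)
  moreover have "normal_variety ?Y"
    using integrally_closed_localization by (auto simp: normal_variety_def local_rings_def)
  moreover have "Ov \<in> ?Y"
  proof -
    let ?Q = "ev u s ` {h. coeff h 0 = 0}"
    have mem: "ev u s h \<in> ?Q \<longleftrightarrow> coeff h 0 = 0" for h by auto
    have "prime_ideal_of A ?Q"
      unfolding prime_ideal_of_def submodule_over_def
    proof (intro conjI ballI impI)
      show "0 \<in> ?Q" using mem[of 0] by simp
      show "?Q \<subseteq> A" by (auto simp: A_def)
      show "1 \<notin> ?Q" using mem[of 1] by simp
    next
      fix x y assume "x \<in> ?Q" "y \<in> ?Q"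
      then show "x + y \<in> ?Q" using mem by (auto simp flip: ev.hom_add)
    next
      fix r x assume "r \<in> A" "x \<in> ?Q"
      then show "r * x \<in> ?Q" using mem by (auto simp: A_def coeff_mult simp flip: ev.hom_mult)
    next
      fix x y assume "x \<in> A" "y \<in> A" "x * y \<in> ?Q"
      then obtain g h where gh: "x = ev u s g" "y = ev u s h" "ev u s (g * h) \<in> ?Q"
        by (auto simp: A_def ev.hom_mult)
      then have "coeff (g * h) 0 = 0" using mem by blast
      then show "x \<in> ?Q \<or> y \<in> ?Q" unfolding gh mem by (simp add: coeff_mult)
    qed
    moreover have "Ov = localization A ?Q"
    proof (rule Set.set_eqI)
      fix f
      have "f \<in> localization A ?Q \<longleftrightarrow> (\<exists>g h. coeff h 0 \<noteq> 0 \<and> f = ev u s g / ev u s h)"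
        unfolding localization_def A_def using mem by blast
      then show "f \<in> Ov \<longleftrightarrow> f \<in> localization A ?Q" using Ov_iff by simp
    qed
    ultimately show ?thesis unfolding local_rings_def by blast
  qed
  ultimately show ?thesis
    unfolding divisors_over_plane_def prime_divisors_def using prime_ideals_Ov by blast
qed

lemma to_fract_mem_Ov: "to_fract f \<in> Ov"
proof -
  obtain g where "to_fract f = ev u s g" using to_fract_mem_range by blast
  then show ?thesis by (cases "g = 0") (auto simp: val_ge_def v_ev)
qed

text \<open>Positivity of \<open>p\<close> and \<open>q\<close> puts both coordinates into the
  contraction of the maximal ideal, and nonzero constants stay outside.\<close>

lemma centre_Ov: "centre Ov = {origin}"
proof -
  let ?P = "{f. to_fract f \<in> max_ideal Ov}"
  have "submodule_over UNIV ?P"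
    unfolding max_ideal_Ov submodule_over_def
  proof (intro conjI ballI)
    show "0 \<in> {f. to_fract f \<in> val_ge v 1}" by (simp add: val_ge_def)
  next
    fix f g assume "f \<in> {f. to_fract f \<in> val_ge v 1}" "g \<in> {f. to_fract f \<in> val_ge v 1}"
    then show "f + g \<in> {f. to_fract f \<in> val_ge v 1}" using val_ge_add by simp
  next
    fix r f assume "f \<in> {f. to_fract f \<in> val_ge v 1}"
    then show "r * f \<in> {f. to_fract f \<in> val_ge v 1}"
      using val_ge_mult[OF to_fract_mem_Ov[of r], of "to_fract f" 1] by simp
  qed
  moreover have "X1 \<in> ?P" "X2 \<in> ?P"
    unfolding max_ideal_Ov using p q by (simp_all add: val_ge_def v_coords)
  ultimately have "origin \<subseteq> ?P" unfolding origin_def by (intro span_over_minimal) auto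
  moreover have "?P \<subseteq> origin"
  proof
    fix f assume f: "f \<in> ?P"
    define c where "c = coeff (coeff f 0) 0"
    have "f - [:[:c:]:] \<in> origin" by (simp add: origin_eq c_def)
    then have "f - [:[:c:]:] \<in> ?P" using \<open>origin \<subseteq> ?P\<close> by blast
    then have "to_fract f - to_fract (f - [:[:c:]:]) \<in> val_ge v 1"
      using val_ge_diff f unfolding max_ideal_Ov by blast
    then have "const c \<in> val_ge v 1" by (simp add: const_def)
    then have "c = 0" by (cases "c = 0") (auto simp: val_ge_def const_eq)
    then show "f \<in> origin" by (simp add: origin_eq c_def)
  qed
  ultimately have "?P = origin" by blast
  then show ?thesis unfolding centre_def using origin_maximal prime_origin by blast
qed

text \<open>Regular functions on the chart have differentials in the span of \<open>du\<close> and
  \<open>ds\<close>, so all regular 2-forms are multiples of \<open>du \<and> ds\<close>. Relative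
  to \<open>dx1 \<and> dx2\<close> this form has value \<open>1 - p - q\<close>.\<close>

lemma order_relative_canonical_le: "order_relative_canonical Ov \<le> enat (p + q - 1)"
proof -
  \<comment> \<open>The coefficients do not depend on \<open>D\<close>, so the same pair serves both
    partial derivatives inside the Jacobian.\<close>
  have partials: "\<exists>F\<in>Ov. \<exists>G\<in>Ov. \<forall>D. derivation D \<longrightarrow> D f = F * D u + G * D s" if fO: "f \<in> Ov" for f
  proof -
    obtain g h where gh: "coeff h 0 \<noteq> 0" "f = ev u s g / ev u s h" using iffD1[OF Ov_iff fO] by blast
    have h: "h \<noteq> 0" using gh(1) by auto
    let ?F = "\<lambda>\<delta>. ev u s (\<delta> g * h - g * \<delta> h) / ev u s (h * h)"
    have "coeff (h * h) 0 \<noteq> 0" using gh(1) by (simp add: coeff_mult)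
    then have "?F \<delta> \<in> Ov" for \<delta> using Ov_iff by blast
    moreover have "D f = ?F (map_poly pderiv) * D u + ?F pderiv * D s" if "derivation D" for D
    proof -
      have nz: "ev u s h \<noteq> 0" using h by simp
      show ?thesis
        unfolding gh(2) derivation.divide[OF that nz] chain_rule[OF that]
        using nz by (simp add: ev.hom_mult ev.hom_minus power2_eq_square field_simps)
    qed
    ultimately show ?thesis by blast
  qed
  have J_val: "jacobian u s \<in> val_ge v (1 - int p - int q)"
    using u s by (simp add: jac val_ge_def divide mult v_coords)
  have "jacobian f g \<in> val_ge v (1 - int p - int q)" if f: "f \<in> Ov" and g: "g \<in> Ov" for f g
  proof -
    obtain F1 F2 where F: "F1 \<in> Ov" "F2 \<in> Ov" "\<And>D. derivation D \<Longrightarrow> D f = F1 * D u + F2 * D s"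
      using partials[OF f] by blast
    obtain G1 G2 where G: "G1 \<in> Ov" "G2 \<in> Ov" "\<And>D. derivation D \<Longrightarrow> D g = G1 * D u + G2 * D s"
      using partials[OF g] by blast
    have "jacobian f g = (F1 * G2 - F2 * G1) * jacobian u s"
      unfolding jacobian_def F(3)[OF d1.derivation_axioms] F(3)[OF d2.derivation_axioms]
        G(3)[OF d1.derivation_axioms] G(3)[OF d2.derivation_axioms]
      by (simp add: algebra_simps)
    moreover have "F1 * G2 - F2 * G1 \<in> Ov" using F(1,2) G(1,2) is_subringD(3,4)[OF is_subring_Ov] by simp
    ultimately show ?thesis using val_ge_mult[OF _ J_val, of _ 0] by simp
  qed
  then have stalk: "canonical_stalk Ov \<subseteq> val_ge v (1 - int p - int q)"
    unfolding canonical_stalk_def by (intro span_over_minimal submodule_val_ge) blast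
  have "n \<le> p + q - 1"
    if "1 \<in> module_prod Ov (ideal_power Ov (max_ideal Ov) n) (canonical_stalk Ov)" for n
  proof -
    let ?m = "int n + (1 - int p - int q)"
    have "module_prod Ov (ideal_power Ov (max_ideal Ov) n) (canonical_stalk Ov) \<subseteq> val_ge v ?m"
      unfolding module_prod_def ideal_power_Ov
    proof (rule span_over_minimal[OF _ submodule_val_ge])
      show "{x * y | x y. x \<in> val_ge v (int n) \<and> y \<in> canonical_stalk Ov} \<subseteq> val_ge v ?m"
        using val_ge_mult[of _ "int n" _ "1 - int p - int q"] stalk by blast
    qed
    then have "1 \<in> val_ge v ?m" using that by blast
    then show ?thesis by (simp add: val_ge_def)
  qed
  then show ?thesis unfolding order_relative_canonical_def by (intro Sup_least) auto
qed

end

section \<open>The divisors of weights (1,1) and (3,2)\<close>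

text \<open>The chart \<open>x1 = u s\<close>, \<open>x2 = s\<close> of the ordinary blow-up of the
  origin.\<close>

interpretation blowup: monomial_chart
  "to_fract X1 / to_fract X2 :: 'k::field_char_0 ratfun" "to_fract X2" 1 0 1 1
proof
  show "jacobian (to_fract X1 / to_fract X2) (to_fract X2 :: 'k ratfun)
      = to_fract X1 / to_fract X2 * to_fract X2 / (to_fract X1 * to_fract X2)"
    using jacobian_slope[of "0 :: 'k"] by (simp add: field_simps)
qed simp_all

text \<open>The chart \<open>x1 = u^2 s^3\<close>, \<open>x2 = u s^2\<close> of the weighted
  blow-up: \<open>u = x1^2 / x2^3\<close> has weight 0, \<open>s = x2^2 / x1\<close> has weight 1,
  and the exponents have determinant \<open>2 * 2 - 1 * 3 = 1\<close>.\<close>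

interpretation cusp: monomial_chart
  "to_fract X1 ^ 2 / to_fract X2 ^ 3 :: 'k::field_char_0 ratfun" "to_fract X2 ^ 2 / to_fract X1" 2 1 3 2
proof
  let ?x = "to_fract X1 :: 'k ratfun" and ?y = "to_fract X2 :: 'k ratfun"
  have nz: "?x \<noteq> 0" "?y \<noteq> 0" by simp_all
  show "?x = (?x ^ 2 / ?y ^ 3) ^ 2 * (?y ^ 2 / ?x) ^ 3"
    using nz by (simp add: power_divide power_mult_distrib flip: power_mult) (simp add: eval_nat_numeral)
  show "?y = (?x ^ 2 / ?y ^ 3) ^ 1 * (?y ^ 2 / ?x) ^ 2"
    using nz by (simp add: power_divide power_mult_distrib flip: power_mult) (simp add: eval_nat_numeral)
  have 1: "partial_x1 (?x ^ 2 / ?y ^ 3) = 2 * ?x / ?y ^ 3"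
    using nz by (simp add: d1.divide d1.power) (simp add: field_simps eval_nat_numeral)
  have 2: "partial_x2 (?x ^ 2 / ?y ^ 3) = - 3 * ?x ^ 2 / ?y ^ 4"
    using nz by (simp add: d2.divide d2.power) (simp add: field_simps eval_nat_numeral)
  have 3: "partial_x1 (?y ^ 2 / ?x) = - (?y ^ 2) / ?x ^ 2" "partial_x2 (?y ^ 2 / ?x) = 2 * ?y / ?x"
    using nz by (simp_all add: d1.divide d1.power d2.divide d2.power) (simp add: power2_eq_square)
  show "jacobian (?x ^ 2 / ?y ^ 3) (?y ^ 2 / ?x) = ?x ^ 2 / ?y ^ 3 * (?y ^ 2 / ?x) / (?x * ?y)"
    unfolding jacobian_def 1 2 3 using nz
    by (simp add: divide_simps) (simp add: algebra_simps eval_nat_numeral)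
qed simp_all

section \<open>Comparison of valuations with the exceptional divisor\<close>

context discrete_valuation
begin

lemma ev_mem_Ov: "u \<in> Ov \<Longrightarrow> s \<in> Ov \<Longrightarrow> ev u s h \<in> Ov"
  using subalgebra_Ov
  by (induction h rule: plane_induct) (auto simp: subalgebra_def ev.hom_add ev.hom_mult)

end

text \<open>The hypothesis \<open>v x2 \<le> v x1\<close> makes \<open>v\<close> non-negative on the
  blow-up chart. There \<open>f\<close> is \<open>x2^n\<close> times a regular function, and each
  factor \<open>x2\<close> contributes at least \<open>m\<close>.\<close>

lemma val_ge_blowup:
  fixes v :: "'k::field_char_0 ratfun \<Rightarrow> int"
  assumes dv: "discrete_valuation v" and v: "v (to_fract X2) \<le> v (to_fract X1)" "int m \<le> v (to_fract X2)"
    and f: "to_fract f \<in> val_ge blowup.v (int n)"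
  shows "to_fract f \<in> val_ge v (int (m * n))"
proof (cases "f = 0")
  case False
  interpret discrete_valuation v by (rule dv)
  obtain h where h: "to_fract f = ev (to_fract X1 / to_fract X2) (to_fract X2) h"
    using blowup.to_fract_mem_range[of f] by blast
  then have "h \<noteq> 0" using False by auto
  then have "n \<le> Polynomial.order 0 h" using f False blowup.v_ev[of h] by (simp add: val_ge_def h)
  then obtain g where g: "h = X2 ^ n * g" using order_0_decomp \<open>h \<noteq> 0\<close> by blast
  have "to_fract X1 / to_fract X2 \<in> Ov" "to_fract X2 \<in> Ov"
    using v by (auto simp: val_ge_def divide)
  then have "ev (to_fract X1 / to_fract X2) (to_fract X2) g \<in> Ov" by (rule ev_mem_Ov)
  moreover have "to_fract X2 ^ n \<in> val_ge v (int (m * n))"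
    using mult_left_mono[OF v(2), of "int n"] by (simp add: val_ge_def power mult.commute)
  ultimately have "to_fract X2 ^ n * ev (to_fract X1 / to_fract X2) (to_fract X2) g \<in> val_ge v (int (m * n) + 0)"
    by (intro val_ge_mult)
  moreover have "to_fract f = to_fract X2 ^ n * ev (to_fract X1 / to_fract X2) (to_fract X2) g"
    unfolding h g by (simp add: ev.hom_mult ev.hom_power)
  ultimately show ?thesis by simp
qed (simp add: val_ge_def)

lemma order_along_blowup:
  fixes v :: "'k::field_char_0 ratfun \<Rightarrow> int"
  assumes dv: "discrete_valuation v" and v: "v (to_fract X2) \<le> v (to_fract X1)" "int m \<le> v (to_fract X2)"
  shows "enat m * order_along blowup.Ov (span_over blowup.Ov (to_fract ` I))
    \<le> order_along (val_ge v 0) (span_over (val_ge v 0) (to_fract ` I))"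
proof (cases "order_along (val_ge v 0) (span_over (val_ge v 0) (to_fract ` I))")
  case (enat M)
  interpret discrete_valuation v by (rule dv)
  have bound: "n * m \<le> M" if "to_fract ` I \<subseteq> val_ge blowup.v (int n)" for n
  proof -
    have "to_fract ` I \<subseteq> val_ge v (int (m * n))" using that val_ge_blowup[OF dv v] by blast
    then have "enat (m * n) \<le> order_along Ov (span_over Ov (to_fract ` I))" by (rule order_along_ge)
    then show ?thesis by (simp add: enat mult.commute)
  qed
  have "n \<le> M div m" if "to_fract ` I \<subseteq> val_ge blowup.v (int n)" "m \<noteq> 0" for n
    using bound[OF that(1)] that(2) by (simp add: less_eq_div_iff_mult_less_eq)
  then have "order_along blowup.Ov (span_over blowup.Ov (to_fract ` I)) \<le> enat (M div m)" if "m \<noteq> 0"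
    unfolding blowup.order_along_span using that by (intro Sup_least) auto
  then have "enat m * order_along blowup.Ov (span_over blowup.Ov (to_fract ` I)) \<le> enat m * enat (M div m)"
    if "m \<noteq> 0" using that by (intro mult_left_mono) auto
  also have "enat m * enat (M div m) \<le> enat M" by simp
  \<comment> \<open>The case \<open>m = 0\<close> stands apart because the division by
    \<open>m\<close> fails there, while \<open>0 * \<infinity> = 0\<close> makes the claim
    trivial.\<close>
  finally show ?thesis unfolding enat by (cases "m = 0") (auto simp: zero_enat_def[symmetric])
qed simp

text \<open>The contraction of the maximal ideal is prime, so it is a point of its own closure and
  must be \<open>origin\<close>.\<close>

lemma (in discrete_valuation) centre_origin:
  assumes "range to_fract \<subseteq> Ov" and "centre Ov = {origin}"
  shows "1 \<le> v (to_fract X1)" "1 \<le> v (to_fract X2)"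
proof -
  let ?P = "{f. to_fract f \<in> max_ideal Ov}"
  have prime: "prime_ideal_of Ov (max_ideal Ov)" using prime_ideals_Ov(2) by blast
  note m = prime_ideal_ofD[OF prime] and m_sub = submodule_overD[OF prime_ideal_ofD(1)[OF prime]]
  have poly: "to_fract f \<in> Ov" for f using assms(1) by blast
  have "prime_ideal_of UNIV ?P"
    unfolding prime_ideal_of_def submodule_over_def
    using m(3,4,5) m_sub(2,3) poly by simp
  then have "?P \<in> centre Ov" unfolding centre_def by blast
  then have "?P = origin" using assms(2) by blast
  moreover have "X1 \<in> origin" "X2 \<in> origin" by (simp_all add: origin_eq X1_def X2_def)
  ultimately have "to_fract X1 \<in> max_ideal Ov" "to_fract X2 \<in> max_ideal Ov" by blast+
  then show "1 \<le> v (to_fract X1)" "1 \<le> v (to_fract X2)"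
    unfolding max_ideal_Ov by (simp_all add: val_ge_def)
qed

text \<open>The valuation of a polynomial \<open>s\<^sup>n g\<close> with \<open>g(u, 0) \<noteq> 0\<close> is \<open>n\<close>, since the residue of \<open>u\<close> is
  transcendental over the algebraically closed constant field.\<close>

lemma valuation_eq_blowup:
  fixes v :: "'k::{alg_closed_field, field_char_0} ratfun \<Rightarrow> int"
  defines "u \<equiv> to_fract X1 / to_fract X2 :: 'k ratfun"
  assumes "discrete_valuation v" and s: "v (to_fract X2) = 1" and u: "u \<in> val_ge v 0"
    and transcendental: "\<And>c. v (u - const c) = 0"
    and f: "f \<noteq> 0"
  shows "v f = blowup.v f"
proof -
  interpret discrete_valuation v by fact
  let ?ev = "ev u (to_fract X2)"
  \<comment> \<open>If \<open>u\<close> were the constant \<open>c\<close>, the form of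
    \<open>jacobian_slope\<close> would vanish.\<close>
  have u_ne: "u - const c \<noteq> 0" for c
    using jacobian_slope[of c] unfolding u_def by (metis derivation.zero derivation_jacobian
        jacobian_swap mult_zero_right neg_equal_0_iff_equal zero_neq_one)
  have ne: "?ev h \<noteq> 0" if "h \<noteq> 0" for h using that unfolding u_def by simp
  \<comment> \<open>Over an algebraically closed field \<open>r\<close> splits into linear factors,
    each of value 0 at \<open>u\<close> by hypothesis.\<close>
  have line: "v (?ev [:r:]) = 0" if "r \<noteq> 0" for r
    using that
  proof (induction "degree r" arbitrary: r rule: less_induct)
    case less
    show ?case
    proof (cases "degree r = 0")
      case True
      then obtain c where "r = [:c:]" by (rule degree_eq_zeroE)
      then show ?thesis using less.prems const_eq by simp
    next
      case False
      then obtain c where "poly r c = 0" using alg_closed_imp_poly_has_root[of r] by blast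
      then obtain r' where r: "r = [:- c, 1:] * r'" by (auto simp: poly_eq_0_iff_dvd elim: dvdE)
      then have r': "r' \<noteq> 0" using less.prems by auto
      have "degree r = Suc (degree r')" unfolding r using r' by (subst degree_mult_eq) auto
      then have IH: "v (?ev [:r':]) = 0" using less.hyps r' by simp
      have "[:r:] = (X1 - [:[:c:]:]) * [:r':]" by (simp add: r X1_def)
      from arg_cong[OF this, of ?ev] have "?ev [:r:] = (u - const c) * ?ev [:r':]"
        by (simp only: ev.hom_mult ev.hom_minus ev_generators)
      then show ?thesis using mult[OF u_ne ne, of "[:r':]" c] IH r' transcendental by simp
    qed
  qed
  have "to_fract X2 \<in> Ov" using s by (simp add: val_ge_def)
  have v_ev: "v (?ev h) = int (Polynomial.order 0 h)" if hne: "h \<noteq> 0" for h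
  proof -
    define n where "n = Polynomial.order 0 h"
    obtain g where g: "h = X2 ^ n * g" "n = n + Polynomial.order 0 g" "g \<noteq> 0"
      using order_0_decomp[OF le_refl hne] unfolding n_def by blast
    obtain r k where gr: "g = pCons r k" by (cases g)
    have "r \<noteq> 0" using g(2,3) order_0_eq_0_iff[OF g(3)] by (simp add: gr)
    \<comment> \<open>The part \<open>r(u)\<close> has value 0 and the rest is divisible by
      \<open>x2\<close>, so \<open>r(u)\<close> determines the value of the sum.\<close>
    have g_eq: "g = [:r:] + X2 * k" by (simp add: gr X2_def)
    have "v (?ev g) = 0"
    proof (cases "k = 0")
      case True
      then show ?thesis using line \<open>r \<noteq> 0\<close> by (simp add: gr)
    next
      case False
      have "0 \<le> v (?ev k)"
        using ev_mem_Ov[OF u \<open>to_fract X2 \<in> Ov\<close>, of k] ne[OF False] by (simp add: val_ge_def)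
      moreover have "?ev (X2 * k) = to_fract X2 * ?ev k" by (simp add: ev.hom_mult)
      ultimately have "v (?ev [:r:]) < v (?ev (X2 * k))"
        using ne[OF False] line[OF \<open>r \<noteq> 0\<close>] s by (simp add: mult)
      then show ?thesis
        using add_eq(2)[OF ne ne, of "[:r:]" "X2 * k"] line[OF \<open>r \<noteq> 0\<close>] \<open>r \<noteq> 0\<close> False
        by (simp add: g_eq ev.hom_add)
    qed
    moreover have "?ev h = to_fract X2 ^ n * ?ev g" by (simp add: g(1) ev.hom_mult ev.hom_power)
    ultimately show ?thesis using ne[OF g(3)] s by (simp add: mult power n_def)
  qed
  obtain g h where gh: "h \<noteq> 0" "f = ev (to_fract X1 / to_fract X2) (to_fract X2) g / ev (to_fract X1 / to_fract X2) (to_fract X2) h"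
    using blowup.ev_fraction_cases by blast
  then have "g \<noteq> 0" using f by auto
  have "blowup.v f = int (Polynomial.order 0 g) - int (Polynomial.order 0 h)"
    unfolding gh(2) by (rule blowup.v_fraction[OF \<open>g \<noteq> 0\<close> gh(1)])
  moreover have "v f = int (Polynomial.order 0 g) - int (Polynomial.order 0 h)"
    unfolding gh(2) u_def[symmetric] using ne \<open>g \<noteq> 0\<close> gh(1) by (simp add: v_ev divide)
  ultimately show ?thesis by simp
qed

section \<open>The example\<close>

definition cusp_ideal :: "'k::field plane set" where
  "cusp_ideal = span_over UNIV {X1^2 + X2^3, X1 * X2^2}"

lemma to_fract_power: "to_fract (f ^ n) = to_fract f ^ n"
  by (induction n) simp_all

lemma cusp_generators: "X1\<^sup>2 + X2 ^ 3 \<in> cusp_ideal" "X1 * X2\<^sup>2 \<in> cusp_ideal"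
  unfolding cusp_ideal_def using span_over_superset by blast+

lemma cusp_polynomial_nonzero: "X1\<^sup>2 + X2 ^ 3 \<noteq> (0 :: 'k::field plane)"
proof
  assume "X1\<^sup>2 + X2 ^ 3 = (0 :: 'k plane)"
  then have "coeff (coeff (X1\<^sup>2 + X2 ^ 3 :: 'k plane) 0) 2 = 0" by simp
  then show False by (simp add: X1_def X2_def eval_nat_numeral)
qed

context discrete_valuation
begin

lemma order_along_cusp_ideal_ge:
  assumes "range to_fract \<subseteq> Ov"
    and "to_fract (X1\<^sup>2 + X2 ^ 3) \<in> val_ge v (int n)" "to_fract (X1 * X2\<^sup>2) \<in> val_ge v (int n)"
  shows "enat n \<le> order_along Ov (span_over Ov (to_fract ` cusp_ideal))"
proof (rule order_along_ge)
  have "submodule_over UNIV {f. to_fract f \<in> val_ge v (int n)}"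
    unfolding submodule_over_def
  proof (intro conjI ballI)
    show "0 \<in> {f. to_fract f \<in> val_ge v (int n)}" by (simp add: val_ge_def)
  next
    fix f g assume "f \<in> {f. to_fract f \<in> val_ge v (int n)}" "g \<in> {f. to_fract f \<in> val_ge v (int n)}"
    then show "f + g \<in> {f. to_fract f \<in> val_ge v (int n)}" using val_ge_add by simp
  next
    fix r f assume "f \<in> {f. to_fract f \<in> val_ge v (int n)}"
    moreover have "to_fract r \<in> Ov" using assms(1) by blast
    ultimately show "r * f \<in> {f. to_fract f \<in> val_ge v (int n)}"
      using val_ge_mult[of "to_fract r" 0 "to_fract f" "int n"] by simp
  qed
  then have "cusp_ideal \<subseteq> {f. to_fract f \<in> val_ge v (int n)}"
    unfolding cusp_ideal_def by (intro span_over_minimal) (use assms(2,3) in auto)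
  then show "to_fract ` cusp_ideal \<subseteq> val_ge v (int n)" by blast
qed

lemma order_along_cusp_ideal_le:
  "order_along Ov (span_over Ov (to_fract ` cusp_ideal)) \<le> enat (nat (v (to_fract (X1\<^sup>2 + X2 ^ 3))))"
proof (rule order_along_le)
  show "to_fract (X1\<^sup>2 + X2 ^ 3) \<in> to_fract ` (cusp_ideal :: 'k plane set)"
    by (intro imageI cusp_generators(1))
  show "to_fract (X1\<^sup>2 + X2 ^ 3) \<noteq> (0 :: 'k ratfun)"
    using cusp_polynomial_nonzero by (simp only: to_fract_eq_0_iff)
qed

lemma order_relative_canonical_coords:
  "int n \<le> v (to_fract X1) + v (to_fract X2) - 1 \<Longrightarrow> enat n \<le> order_relative_canonical Ov"
  using order_relative_canonical_ge[of "to_fract X1" "to_fract X2" 1 n] by simp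

text \<open>The third claim is \<open>n + 1 - (2/3) m \<ge> 2/3\<close> cleared of denominators. The
  last one locates where equality is possible.\<close>

lemma order_bounds:
  assumes "1 \<le> v (to_fract X1)" "1 \<le> v (to_fract X2)"
  obtains n m where "enat n \<le> order_relative_canonical Ov"
    "order_along Ov (span_over Ov (to_fract ` cusp_ideal)) \<le> enat m"
    "2 * m + 2 \<le> 3 * (n + 1)"
    "v (to_fract X1) = 1 \<and> v (to_fract X2) = 1 \<or> 2 * m + 2 < 3 * (n + 1)"
proof -
  define x y :: "'k ratfun" where "x = to_fract X1" and "y = to_fract X2"
  have nz: "x \<noteq> 0" "y \<noteq> 0" "x\<^sup>2 + y ^ 3 \<noteq> 0"
    using cusp_polynomial_nonzero by (simp_all add: x_def y_def flip: to_fract_power to_fract_add)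
  have xy: "1 \<le> v x" "1 \<le> v y" using assms by (simp_all add: x_def y_def)
  define e where "e = v (x\<^sup>2 + y ^ 3)"
  have "to_fract (X1\<^sup>2 + X2 ^ 3) = x\<^sup>2 + y ^ 3" by (simp add: x_def y_def to_fract_power)
  then have ord: "order_along Ov (span_over Ov (to_fract ` cusp_ideal)) \<le> enat (nat e)"
    using order_along_cusp_ideal_le by (simp add: e_def)
  have pow: "v (x\<^sup>2) = 2 * v x" "v (y ^ 3) = 3 * v y" using nz by (simp_all add: power)
  consider "2 * v x < 3 * v y" | "3 * v y < 2 * v x" | "2 * v x = 3 * v y" by linarith
  then show thesis
  proof cases
    case 1
    \<comment> \<open>With \<open>n + 1 = v x + v y\<close> and \<open>m = 2 v x\<close> the claim
      reads \<open>v x + 2 \<le> 3 v y\<close>. As \<open>3 v y \<ge> 2 v x + 1\<close>, equality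
      forces both values to be 1.\<close>
    then have "e = 2 * v x" using add_eq(2)[of "x\<^sup>2" "y ^ 3"] nz pow by (simp add: e_def)
    moreover have "enat (nat (v x + v y - 1)) \<le> order_relative_canonical Ov"
      using xy by (intro order_relative_canonical_coords) (simp add: x_def y_def)
    ultimately show thesis
      using that[of "nat (v x + v y - 1)" "nat e"] ord xy 1 by (simp add: x_def y_def) linarith
  next
    case 2
    \<comment> \<open>Here the claim reads \<open>3 v y + 2 \<le> 3 v x\<close>, and
      \<open>2 v x > 3 v y\<close> makes it strict.\<close>
    then have "e = 3 * v y"
      using add_eq(2)[of "y ^ 3" "x\<^sup>2"] nz pow by (simp add: e_def add.commute)
    moreover have "enat (nat (v x + v y - 1)) \<le> order_relative_canonical Ov"
      using xy by (intro order_relative_canonical_coords) (simp add: x_def y_def)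
    ultimately show thesis
      using that[of "nat (v x + v y - 1)" "nat e"] ord xy 2 by (simp add: x_def y_def)
  next
    case 3
    \<comment> \<open>Now \<open>v x = 3 d\<close> and \<open>v y = 2 d\<close> with
      \<open>d \<ge> 1\<close>. The cusp form gives \<open>n + 1 = e - d\<close>, and the claim
      \<open>3 d + 2 \<le> e\<close> is strict because \<open>e \<ge> 6 d\<close>.\<close>
    have "3 \<le> v x" using 3 xy by presburger
    have e: "2 * v x \<le> e"
      using add_ge[of "x\<^sup>2" "y ^ 3"] nz pow 3 by (simp add: e_def)
    have "enat (nat (e + v y - v x - 1)) \<le> order_relative_canonical Ov"
    proof (rule order_relative_canonical_ge)
      show "y ^ 5 / x\<^sup>2 * jacobian ((x\<^sup>2 + y ^ 3) / y ^ 3) (x / y) = 1"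
        unfolding x_def y_def by (rule jacobian_cusp)
      show "int (nat (e + v y - v x - 1))
          \<le> v ((x\<^sup>2 + y ^ 3) / y ^ 3) + v (x / y) + v (y ^ 5 / x\<^sup>2) - 1"
        using nz e xy 3 by (simp add: divide power flip: e_def)
    qed (use nz in simp_all)
    then show thesis
      using that[of "nat (e + v y - v x - 1)" "nat e"] ord xy 3 e \<open>3 \<le> v x\<close> by (simp add: x_def y_def)
  qed
qed

end

lemma cusp_polynomial_valuation:
  assumes "discrete_valuation (v :: 'k::field ratfun \<Rightarrow> int)"
  shows "2 * v (to_fract X1) < 3 * v (to_fract X2) \<Longrightarrow>
      v (to_fract (X1\<^sup>2 + X2 ^ 3)) = 2 * v (to_fract X1)"
    "v (to_fract (X1 * X2\<^sup>2)) = v (to_fract X1) + 2 * v (to_fract X2)"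
proof -
  interpret discrete_valuation v by fact
  have pow: "v (to_fract X1 ^ 2) = 2 * v (to_fract X1)" "v (to_fract X2 ^ n) = int n * v (to_fract X2)" for n
    by (simp_all add: power)
  show "v (to_fract (X1\<^sup>2 + X2 ^ 3)) = 2 * v (to_fract X1)" if "2 * v (to_fract X1) < 3 * v (to_fract X2)"
    using add_eq(2)[of "to_fract X1 ^ 2" "to_fract X2 ^ 3"] that by (simp add: to_fract_power pow)
  show "v (to_fract (X1 * X2\<^sup>2)) = v (to_fract X1) + 2 * v (to_fract X2)"
    by (simp add: to_fract_power mult pow)
qed

text \<open>These values give the log discrepancy \<open>1 + 1 - (2/3) 2 = 2/3\<close> along
  \<open>E\<close>. The generators have values 2 and 3.\<close>

lemma order_blowup:
  "order_relative_canonical (blowup.Ov :: 'k::field_char_0 ratfun set) = enat 1"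
  "order_along blowup.Ov (span_over blowup.Ov (to_fract ` (cusp_ideal :: 'k plane set))) = enat 2"
proof -
  show "order_relative_canonical (blowup.Ov :: 'k ratfun set) = enat 1"
    using blowup.order_relative_canonical_le[where 'k = 'k]
      blowup.order_relative_canonical_coords[of 1, where 'k = 'k] by (simp add: blowup.v_coords)
  have v: "blowup.v (to_fract (X1\<^sup>2 + X2 ^ 3) :: 'k ratfun) = 2"
    "blowup.v (to_fract (X1 * X2\<^sup>2) :: 'k ratfun) = 3"
    using cusp_polynomial_valuation[OF blowup.discrete_valuation_axioms[where 'k = 'k]]
    by (simp_all add: blowup.v_coords del: to_fract_add to_fract_mult)
  show "order_along blowup.Ov (span_over blowup.Ov (to_fract ` (cusp_ideal :: 'k plane set))) = enat 2"
  proof (rule antisym)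
    show "order_along blowup.Ov (span_over blowup.Ov (to_fract ` (cusp_ideal :: 'k plane set))) \<le> enat 2"
      using blowup.order_along_cusp_ideal_le[where 'k = 'k] v(1) by (simp del: to_fract_add)
    show "enat 2 \<le> order_along blowup.Ov (span_over blowup.Ov (to_fract ` (cusp_ideal :: 'k plane set)))"
      by (rule blowup.order_along_cusp_ideal_ge)
        (use blowup.to_fract_mem_Ov in \<open>auto simp: val_ge_def v simp del: to_fract_add to_fract_mult\<close>)
  qed
qed

text \<open>Here \<open>4 = 3 + 2 - 1\<close>, and 6 is the common weight of \<open>x1^2\<close> and
  \<open>x2^3\<close>, below the weight 7 of \<open>x1 x2^2\<close>. The inequalities point in the
  directions that bound the log discrepancy from above.\<close>

lemma order_cusp:
  "order_relative_canonical (cusp.Ov :: 'k::field_char_0 ratfun set) \<le> enat 4"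
  "enat 6 \<le> order_along cusp.Ov (span_over cusp.Ov (to_fract ` (cusp_ideal :: 'k plane set)))"
proof -
  show "order_relative_canonical (cusp.Ov :: 'k ratfun set) \<le> enat 4"
    using cusp.order_relative_canonical_le[where 'k = 'k] by simp
  have "(to_fract X1 :: 'k ratfun) ^ 2 \<in> val_ge cusp.v 6" "(to_fract X2 :: 'k ratfun) ^ 3 \<in> val_ge cusp.v 6"
    by (simp_all add: val_ge_def cusp.power cusp.v_coords)
  then have "(to_fract (X1\<^sup>2 + X2 ^ 3) :: 'k ratfun) \<in> val_ge cusp.v 6"
    using cusp.val_ge_add by (simp add: to_fract_power)
  moreover have "(to_fract (X1 * X2\<^sup>2) :: 'k ratfun) \<in> val_ge cusp.v 6"
    using cusp_polynomial_valuation(2)[OF cusp.discrete_valuation_axioms[where 'k = 'k]]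
    by (simp add: val_ge_def cusp.v_coords del: to_fract_mult)
  ultimately show "enat 6 \<le> order_along cusp.Ov (span_over cusp.Ov (to_fract ` (cusp_ideal :: 'k plane set)))"
    by (intro cusp.order_along_cusp_ideal_ge) (use cusp.to_fract_mem_Ov in auto)
qed

section \<open>Log discrepancies with respect to the cusp ideal\<close>

lemma log_discrepancy_add:
  "log_discrepancy E ({#(I, r)#} + \<bb>) = 1 + ereal_of_enat (order_relative_canonical E)
    - (ereal r * ereal_of_enat (order_along E (span_over E (to_fract ` I))) + ord_R_ideal E \<bb>)"
  by (simp add: log_discrepancy_def ord_R_ideal_def)

lemma log_discrepancy_ge:
  assumes "enat n \<le> order_relative_canonical E" "order_along E (span_over E (to_fract ` I)) \<le> enat m" "0 \<le> r"
  shows "ereal (1 + real n - r * real m) \<le> log_discrepancy E {#(I, r)#}"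
proof -
  obtain k where k: "order_along E (span_over E (to_fract ` I)) = enat k" "k \<le> m"
    using assms(2) by (cases "order_along E (span_over E (to_fract ` I))") auto
  have "r * real k \<le> r * real m" using k(2) assms(3) by (intro mult_left_mono) auto
  then have "1 + ereal (real n) - ereal (r * real m) \<le> 1 + ereal (real n) - ereal (r * real k)" by simp
  also have "\<dots> \<le> 1 + ereal_of_enat (order_relative_canonical E) - ereal (r * real k)"
    using assms(1) by (intro ereal_minus_mono add_left_mono) (auto simp flip: ereal_of_enat_simps(1))
  also have "\<dots> = log_discrepancy E {#(I, r)#}"
    using k(1) by (simp add: log_discrepancy_def ord_R_ideal_def)
  finally show ?thesis by (simp add: one_ereal_def)
qed

lemma divisor_over_origin:
  fixes F :: "'k::field ratfun set"
  assumes "F \<in> divisors_over_plane" "centre F = {origin}"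
  obtains v where "discrete_valuation v" "F = val_ge v 0"
    "1 \<le> v (to_fract X1)" "1 \<le> v (to_fract X2)"
proof -
  obtain v where v: "discrete_valuation v" "F = val_ge v 0" "range to_fract \<subseteq> F"
    using divisor_is_valuation_ring[OF assms(1)] by (auto simp: valuation_ring_of_eq)
  then show thesis using that discrete_valuation.centre_origin[OF v(1)] assms(2) by simp
qed

text \<open>In the case of equality \<open>order_bounds\<close> leaves only coordinates of value 1.
  The ideal then has order at most 2, which caps the canonical order at 1; a constant
  \<open>c\<close> with \<open>x1/x2 - c\<close> of positive value would exceed this cap.\<close>

lemma log_discrepancy_cusp_ideal:
  fixes F :: "'k::{alg_closed_field, field_char_0} ratfun set"
  assumes "F \<in> divisors_over_plane" "centre F = {origin}"
  shows "2/3 \<le> log_discrepancy F {#(cusp_ideal, 2/3)#}"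
    and "log_discrepancy F {#(cusp_ideal, 2/3)#} = 2/3 \<Longrightarrow> same_divisor F blowup.Ov"
proof -
  obtain v where v: "discrete_valuation v" "F = val_ge v 0" "1 \<le> v (to_fract X1)" "1 \<le> v (to_fract X2)"
    using divisor_over_origin[OF assms] by blast
  interpret discrete_valuation v by (rule v(1))
  let ?u = "to_fract X1 / to_fract X2 :: 'k ratfun"
  obtain n m where nm: "enat n \<le> order_relative_canonical Ov"
    "order_along Ov (span_over Ov (to_fract ` cusp_ideal)) \<le> enat m" "2 * m + 2 \<le> 3 * (n + 1)"
    "v (to_fract X1) = 1 \<and> v (to_fract X2) = 1 \<or> 2 * m + 2 < 3 * (n + 1)"
    by (rule order_bounds[OF v(3,4)])
  have ge: "ereal (1 + real n - 2/3 * real m) \<le> log_discrepancy F {#(cusp_ideal, 2/3)#}"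
    unfolding v(2) using nm(1,2) by (rule log_discrepancy_ge) simp
  have two_thirds: "2/3 = ereal (2/3)" by (simp add: numeral_eq_ereal)
  have "real (2 * m + 2) \<le> real (3 * (n + 1))" using nm(3) by (rule of_nat_mono)
  then have "2/3 \<le> 1 + real n - 2/3 * real m" by simp
  then show "2/3 \<le> log_discrepancy F {#(cusp_ideal, 2/3)#}"
    using ge unfolding two_thirds by (meson ereal_less_eq(3) order_trans)
  assume eq: "log_discrepancy F {#(cusp_ideal, 2/3)#} = 2/3"
  have "\<not> 2 * m + 2 < 3 * (n + 1)"
  proof
    assume "2 * m + 2 < 3 * (n + 1)"
    then have "real (2 * m + 2) < real (3 * (n + 1))" by (simp only: of_nat_less_iff)
    then show False using ge unfolding eq two_thirds by simp
  qed
  then have v1: "v (to_fract X1) = 1" "v (to_fract X2) = 1" using nm(4) by auto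
  then have ord: "order_along Ov (span_over Ov (to_fract ` cusp_ideal)) \<le> enat 2"
    using order_along_cusp_ideal_le cusp_polynomial_valuation(1)[OF v(1)] by (simp del: to_fract_add)
  \<comment> \<open>The bound \<open>1 + n' - (2/3) 2 \<le> 2/3\<close> means
    \<open>n' \<le> 1\<close>.\<close>
  have bound: "n' \<le> 1" if "enat n' \<le> order_relative_canonical Ov" for n'
    using log_discrepancy_ge[OF that ord, of "2/3"] eq unfolding v(2) two_thirds by simp
  have "v (?u - const c) = 0" for c
  proof -
    have J: "to_fract X2 * jacobian (?u - const c) (to_fract X2) = 1" by (rule jacobian_slope)
    then have nz: "?u - const c \<noteq> 0" using derivation.zero[OF derivation_jacobian] jacobian_swap
      by (metis mult_zero_right neg_equal_0_iff_equal zero_neq_one)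
    have "v ?u = 0" using v1 by (simp add: divide)
    then have "?u \<in> Ov" by (simp add: val_ge_def)
    moreover have "const c \<in> Ov" using subalgebra_Ov unfolding subalgebra_def by blast
    ultimately have "?u - const c \<in> Ov" by (rule val_ge_diff)
    then have "0 \<le> v (?u - const c)" using nz by (simp add: val_ge_def)
    \<comment> \<open>With \<open>f = x1/x2 - c\<close> and \<open>g = h = x2\<close> the bound is
      \<open>v f + 1 + 1 - 1\<close>.\<close>
    moreover have "enat (nat (v (?u - const c) + 1)) \<le> order_relative_canonical Ov"
      using J nz v1 \<open>0 \<le> v (?u - const c)\<close>
      by (intro order_relative_canonical_ge[of "?u - const c" "to_fract X2" "to_fract X2"]) simp_all
    then have "nat (v (?u - const c) + 1) \<le> 1" by (rule bound)
    ultimately show ?thesis by simp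
  qed
  moreover have "?u \<in> Ov" using v1 by (simp add: val_ge_def divide)
  ultimately have "v f = blowup.v f" if "f \<noteq> 0" for f
    using valuation_eq_blowup[OF v(1) v1(2)] that by blast
  then show "same_divisor F blowup.Ov"
    unfolding same_divisor_def v(2) using valuation_Ov blowup.valuation_Ov[where 'k = 'k] by simp
qed

text \<open>The factor 2 is the value of \<open>x2\<close> along \<open>F\<close>; the comparison is
  made ideal by ideal and summed with the exponents.\<close>

lemma ord_R_ideal_cusp_ge:
  fixes \<bb> :: "'k::field_char_0 rideal"
  assumes "R_ideal \<bb>"
  shows "2 * ord_R_ideal blowup.Ov \<bb> \<le> ord_R_ideal cusp.Ov \<bb>"
  using assms
proof (induction \<bb>)
  case empty
  then show ?case by (simp add: ord_R_ideal_def)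
next
  case (add Ir \<bb>)
  obtain I r where Ir: "Ir = (I, r)" by (cases Ir)
  have r: "0 < r" and "R_ideal \<bb>" using add.prems by (auto simp: R_ideal_def Ir)
  let ?b = "order_along blowup.Ov (span_over blowup.Ov (to_fract ` I))"
  let ?c = "order_along cusp.Ov (span_over cusp.Ov (to_fract ` I))"
  have "enat 2 * ?b \<le> ?c"
    by (rule order_along_blowup[OF cusp.discrete_valuation_axioms]) (simp_all add: cusp.v_coords)
  then have "ereal_of_enat (enat 2 * ?b) \<le> ereal_of_enat ?c" by (simp only: ereal_of_enat_le_iff)
  then have "2 * ereal_of_enat ?b \<le> ereal_of_enat ?c" by (simp add: ereal_of_enat_mult)
  then have "ereal r * (2 * ereal_of_enat ?b) \<le> ereal r * ereal_of_enat ?c"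
    using r by (intro ereal_mult_left_mono) auto
  then have "2 * (ereal r * ereal_of_enat ?b) \<le> ereal r * ereal_of_enat ?c" by (simp add: mult.left_commute)
  moreover have "2 * ord_R_ideal blowup.Ov \<bb> \<le> ord_R_ideal cusp.Ov \<bb>" using add.IH \<open>R_ideal \<bb>\<close> .
  ultimately have "2 * (ereal r * ereal_of_enat ?b) + 2 * ord_R_ideal blowup.Ov \<bb>
      \<le> ereal r * ereal_of_enat ?c + ord_R_ideal cusp.Ov \<bb>" by (rule add_mono)
  \<comment> \<open>A finite non-negative factor distributes even over infinite orders, such as that
    of the zero ideal.\<close>
  moreover have "2 * (ereal r * ereal_of_enat ?b + ord_R_ideal blowup.Ov \<bb>)
      = 2 * (ereal r * ereal_of_enat ?b) + 2 * ord_R_ideal blowup.Ov \<bb>"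
    by (rule ereal_pos_distrib) simp_all
  ultimately show ?case by (simp add: ord_R_ideal_def Ir)
qed

lemma log_discrepancy_cusp_negative:
  fixes \<bb> :: "'k::field_char_0 rideal"
  assumes \<bb>: "R_ideal \<bb>" and zero: "log_discrepancy blowup.Ov ({#(cusp_ideal, 2/3)#} + \<bb>) = 0"
  shows "log_discrepancy cusp.Ov ({#(cusp_ideal, 2/3)#} + \<bb>) < 0"
proof -
  let ?o = "order_along cusp.Ov (span_over cusp.Ov (to_fract ` (cusp_ideal :: 'k plane set)))"
  note zero' = zero[unfolded log_discrepancy_add order_blowup]
  \<comment> \<open>The equation \<open>2 - 4/3 - ord = 0\<close> has the single solution
    \<open>2/3\<close>, and an infinite order is incompatible with it.\<close>
  have b: "ord_R_ideal blowup.Ov \<bb> = ereal (2/3)"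
  proof (cases "ord_R_ideal blowup.Ov \<bb>")
    case (real x)
    then show ?thesis using zero' by (simp add: one_ereal_def zero_ereal_def)
  qed (use zero' in simp_all)
  have "ereal (4/3) \<le> ord_R_ideal cusp.Ov \<bb>"
    using ord_R_ideal_cusp_ge[OF \<bb>] unfolding b by (simp add: numeral_eq_ereal)
  moreover have "ereal 4 \<le> ereal (2/3) * ereal_of_enat ?o"
    using order_cusp(2)[where 'k = 'k] by (cases ?o) auto
  ultimately have "ereal 4 + ereal (4/3) \<le> ereal (2/3) * ereal_of_enat ?o + ord_R_ideal cusp.Ov \<bb>"
    by (intro add_mono)
  moreover have "1 + ereal_of_enat (order_relative_canonical (cusp.Ov :: 'k ratfun set)) \<le> ereal 5"
    using order_cusp(1)[where 'k = 'k]
    by (cases "order_relative_canonical (cusp.Ov :: 'k ratfun set)") (auto simp: one_ereal_def)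
  ultimately have "log_discrepancy cusp.Ov ({#(cusp_ideal, 2/3)#} + \<bb>) \<le> ereal 5 - (ereal 4 + ereal (4/3))"
    unfolding log_discrepancy_add by (intro ereal_minus_mono)
  also have "\<dots> < 0" by simp
  finally show ?thesis .
qed

theorem mainTheorem2:
  fixes \<aa> :: "'k::{alg_closed_field, field_char_0} plane set"
  assumes "\<aa> = span_over UNIV {X1^2 + X2^3, X1 * X2^2}"
  shows "mld origin {#(\<aa>, 2/3)#} = 2/3 \<and>
    (\<exists>E. computes_mld E origin {#(\<aa>, 2/3)#}
       \<and> (\<forall>F. computes_mld F origin {#(\<aa>, 2/3)#} \<longrightarrow> same_divisor F E)
       \<and> (\<forall>\<bb>. R_ideal \<bb> \<and> mld origin ({#(\<aa>, 2/3)#} + \<bb>) = 0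
              \<longrightarrow> \<not> computes_mld E origin ({#(\<aa>, 2/3)#} + \<bb>)))"
proof -
  have two_thirds: "2/3 = ereal (2/3)" by (simp add: numeral_eq_ereal)
  let ?E = "blowup.Ov :: 'k ratfun set"
  have \<aa>: "\<aa> = cusp_ideal" using assms by (simp only: cusp_ideal_def)
  have E: "?E \<in> divisors_over_plane" "centre ?E = {origin}"
    by (rule blowup.Ov_mem_divisors, rule blowup.centre_Ov)
  have ld: "log_discrepancy ?E {#(\<aa>, 2/3)#} = 2/3"
    using log_discrepancy_add[of ?E \<aa> "2/3" "{#}"]
    by (simp add: \<aa> order_blowup ord_R_ideal_def two_thirds one_ereal_def)
  have mld: "mld origin {#(\<aa>, 2/3)#} = 2/3"
    unfolding mld_def
  proof (rule antisym)
    show "(INF E\<in>{E \<in> divisors_over_plane. centre E = {origin}}. log_discrepancy E {#(\<aa>, 2/3)#}) \<le> 2/3"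
      using E ld by (intro INF_lower2[of ?E]) auto
    show "2/3 \<le> (INF E\<in>{E \<in> divisors_over_plane. centre E = {origin}}. log_discrepancy E {#(\<aa>, 2/3)#})"
      unfolding \<aa> by (intro INF_greatest log_discrepancy_cusp_ideal(1)) auto
  qed
  have "same_divisor F ?E" if "computes_mld F origin {#(\<aa>, 2/3)#}" for F
  proof -
    have F: "F \<in> divisors_over_plane" "centre F = {origin}"
      and "log_discrepancy F {#(\<aa>, 2/3)#} = 2/3"
      using that unfolding computes_mld_def mld two_thirds by auto
    then show ?thesis unfolding \<aa> by (intro log_discrepancy_cusp_ideal(2))
  qed
  moreover have "\<not> computes_mld ?E origin ({#(\<aa>, 2/3)#} + \<bb>)"
    if \<bb>: "R_ideal \<bb>" and zero: "mld origin ({#(\<aa>, 2/3)#} + \<bb>) = 0" for \<bb>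
  proof
    assume "computes_mld ?E origin ({#(\<aa>, 2/3)#} + \<bb>)"
    \<comment> \<open>The minimal log discrepancy is 0, which excludes the alternative with value
      \<open>-\<infinity>\<close> in \<open>computes_mld\<close>.\<close>
    then have "log_discrepancy ?E ({#(\<aa>, 2/3)#} + \<bb>) = 0"
      unfolding computes_mld_def zero by simp
    then have "log_discrepancy cusp.Ov ({#(\<aa>, 2/3)#} + \<bb>) < 0"
      unfolding \<aa> by (rule log_discrepancy_cusp_negative[OF \<bb>])
    \<comment> \<open>The divisor \<open>F\<close> also has centre \<open>origin\<close>, so its
      negative log discrepancy pushes the infimum below 0.\<close>
    moreover have "mld origin ({#(\<aa>, 2/3)#} + \<bb>) \<le> log_discrepancy cusp.Ov ({#(\<aa>, 2/3)#} + \<bb>)"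
      unfolding mld_def by (rule INF_lower) (simp add: cusp.Ov_mem_divisors cusp.centre_Ov)
    ultimately show False unfolding zero by simp
  qed
  moreover have "computes_mld ?E origin {#(\<aa>, 2/3)#}"
    unfolding computes_mld_def mld using E ld by simp
  ultimately show ?thesis using mld by blast
qed

end
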